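(* Let $L\ge2$ and let $0<m<L$. Let $\bar S^{(0)}_m(L)$ be the average Rényi-$0$ entropy at bond $m$ of states distributed according to the stationary distribution of the unitary circuit game with matchgates and gate disentangler on $L$ qubits at the critical point $p=\tfrac12$. Then $$\bar S^{(0)}_m(L)=m(L-m)\,\frac{T(L-2)}{T(L)},$$ where $T$ denotes the sequence of telephone numbers.
   Context: Telephone numbers: $T(0)=T(1)=1$ and $T(n+1)=T(n)+n\,T(n-1)$ for $n\ge1$. Matchgate: a two-qubit unitary on nearest-neighbor qubits, of the form $G(A,B)$ acting as $A$ on $\mathrm{span}(|00\rangle,|11\rangle)$ and as $B$ on $\mathrm{span}(|01\rangle,|10\rangle)$, with $A,B$ unitary $2\times 2$ and $\det A=\det B$. $U_{j,j+1}$ denotes a gate acting on qubits $j,j+1$ ("bond $j$") of a line of $L$ qubits. Products act from right to left. Right standard form (RSF): a circuit is in the RSF (has the RSF layout) labeled by pairs of integers $((k_i,l_i))_{i=1}^{n_d}$, where $0\le n_d\le L/2$, $k_1\ge1$, $k_i\le k_{i+1}-2$, $1\le l_i\le L-k_i$, if it is the product $D^{(1)}\cdots D^{(n_d)}$ with $D^{(i)}=U^{(i,l_i)}_{k_i+l_i-1,k_i+l_i}\cdots U^{(i,1)}_{k_i,k_i+1}$. Circuits differing only by exchanging gates on disjoint qubits are identified. An RSF circuit $C$ represents the state $C|0\rangle^{\otimes L}$. Absorption algorithm: given an RSF matchgate circuit and a matchgate $A$ applied after it on bond $q$, it produces an RSF circuit representing the same state. "Locally" means up to exchanging gates on disjoint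 qubits, and "$\cdots|000\rangle$" means that no other gate acts earlier on the three involved qubits. At the start and after each step, if $A$ is adjacent (up to exchanging gates on disjoint qubits) to another gate on the same bond, the two are multiplied into one gate and the algorithm terminates. Step 1: if $A$ is locally in a sequence $A_{i-1,i}U_{i,i+1}U'_{i-1,i}$, replace it by an equal product $V_{i,i+1}V'_{i-1,i}A'_{i,i+1}$ of matchgates, set $A\leftarrow A'$, repeat Step 1; otherwise go to Step 2. Step 2: if $A$ is locally in a sequence $A_{i-1,i}U_{i,i+1}|000\rangle$, replace it by an equal $V_{i,i+1}A'_{i-1,i}|000\rangle$, set $A\leftarrow A'$; go to Step 3. Step 3: if $A$ is locally in a sequence $U_{i-1,i}A_{i,i+1}|000\rangle$, replace it by an equal $A'_{i,i+1}V_{i-1,i}|000\rangle$, set $A\leftarrow A'$; go to Step 4. Step 4: if $A$ is locally in a sequence $U_{i-1,i}U'_{i,i+1}A_{i-1,i}$, replace it by an equal product $A'_{i,i+1}V_{i-1,i}V'_{i,i+1}$, set $A\leftarrow A'$, repeat Step 4; otherwise terminate. (All these replacements by matchgates are always possible.) The resulting layout depends only on the initial layout and on $q$. Unitary circuit game with gate disentangler, with disentangling probability $p$: the state is kept as an RSF matchgate circuit. In each step a bond $b\in\{1,\dots,L-1\}$ is chosen uniformly at random. With probability $1-p$ (entangler) a random matchgate (Haar distributed) is applied on bond $b$ and absorbed by the absorption algorithm. With probability $p$ (disentangler) the following is done: if the state represented by the current RSF circuit $C$ can be rewritten, by running the absorption algorithm in reverse, as $A_{b,b+1}C'|0\rangle^{\otimes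 L}$ with $C'$ an RSF circuit having one gate fewer than $C$ (i.e. the layout of $C'$ is such that absorbing a gate on bond $b$ into it yields the layout of $C$), then $A^\dagger$ is applied on bond $b$, giving $C'$; otherwise nothing is done. Thus the game induces a Markov chain on the finite set of RSF layouts on $L$ qubits; the stationary distribution is the distribution reached after evolving for a sufficiently long time. Rényi-$0$ entropy: $S^{(0)}_m(|\psi\rangle)$ is the base-2 logarithm of the Schmidt rank of $|\psi\rangle$ across the bipartition $1\ldots m\,|\,m+1\ldots L$, with $S^{(0)}_0=S^{(0)}_L=0$. Standing (genericity) convention: each gate in an RSF circuit increases it maximally, i.e. starting from $S^{(0)}\equiv0$, applying a gate of the circuit on bond $m$ replaces $S^{(0)}_m$ by $1+\min\{S^{(0)}_{m-1},S^{(0)}_{m+1}\}$ and leaves the other values unchanged; so the entropy profile is determined by the RSF layout. $\bar S^{(0)}_m(L)$ is the expectation of $S^{(0)}_m$ over the stationary distribution. *)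

theory Defs
  imports "HOL-Probability.Probability"
begin

fun telephone :: "nat \<Rightarrow> nat" where
  "telephone 0 = 1"
| "telephone (Suc 0) = 1"
| "telephone (Suc (Suc n)) = telephone (Suc n) + Suc n * telephone n"

section \<open>Matchgate circuits and their states\<close>

text \<open>
  Qubits are numbered from 1, and qubit \<open>j\<close> is entry \<open>j - 1\<close> of a bit string. A state of \<open>L\<close>
  qubits is given by its amplitudes on the bit strings of length \<open>L\<close>; its values on other lists are
  irrelevant.
\<close>

type_synonym state = "bool list \<Rightarrow> complex"

text \<open>
  \<open>Gate b A B\<close> is \<open>G(A,B)\<close> on the qubits \<open>b, b + 1\<close>. Rows and columns of both matrices are indexed by
  the value of the first of the two qubits: \<open>False, True\<close> stand for \<open>|00>, |11>\<close> in \<open>A\<close>, and for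
  \<open>|01>, |10>\<close> in \<open>B\<close>.
\<close>

datatype gate = Gate (gate_bond: nat) (even_block: "complex^bool^bool") (odd_block: "complex^bool^bool")

definition adjoint_matrix :: "complex^'n^'n \<Rightarrow> complex^'n^'n" where
  "adjoint_matrix A = (\<chi> i j. cnj (A $ j $ i))"

definition unitary_matrix :: "complex^'n^'n \<Rightarrow> bool" where
  "unitary_matrix A \<longleftrightarrow> A ** adjoint_matrix A = mat 1 \<and> adjoint_matrix A ** A = mat 1"

definition matchgate :: "nat \<Rightarrow> gate \<Rightarrow> bool" where
  "matchgate L g \<longleftrightarrow> 1 \<le> gate_bond g \<and> gate_bond g < L
     \<and> unitary_matrix (even_block g) \<and> unitary_matrix (odd_block g)
     \<and> det (even_block g) = det (odd_block g)"

fun apply_gate :: "gate \<Rightarrow> state \<Rightarrow> state" where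
  "apply_gate (Gate b A B) \<psi> = (\<lambda>x.
     if x ! (b - 1) = x ! b
     then (\<Sum>c\<in>UNIV. A $ (x ! b) $ c * \<psi> (x[b - 1 := c, b := c]))
     else (\<Sum>c\<in>UNIV. B $ (x ! (b - 1)) $ c * \<psi> (x[b - 1 := c, b := \<not> c])))"

definition zero_state :: state where
  "zero_state x = (if True \<in> set x then 0 else 1)"

text \<open>A circuit is the list of its gates in the order of the operator product, so its last gate acts first.\<close>

definition circuit_state :: "gate list \<Rightarrow> state" where
  "circuit_state c = foldr apply_gate c zero_state"

section \<open>Schmidt rank and entropy\<close>

definition bits :: "nat \<Rightarrow> bool list set" where
  "bits n = {x. length x = n}"

definition orthonormal_family :: "nat \<Rightarrow> nat \<Rightarrow> (nat \<Rightarrow> state) \<Rightarrow> bool" where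
  "orthonormal_family n r u \<longleftrightarrow>
     (\<forall>i<r. \<forall>j<r. (\<Sum>x\<in>bits n. cnj (u i x) * u j x) = (if i = j then 1 else 0))"

definition schmidt_decomposition ::
    "nat \<Rightarrow> nat \<Rightarrow> state \<Rightarrow> nat \<Rightarrow> (nat \<Rightarrow> real) \<Rightarrow> (nat \<Rightarrow> state) \<Rightarrow> (nat \<Rightarrow> state) \<Rightarrow> bool" where
  "schmidt_decomposition L m \<psi> r s u v \<longleftrightarrow>
     (\<forall>i<r. s i > 0) \<and> orthonormal_family m r u \<and> orthonormal_family (L - m) r v
     \<and> (\<forall>x\<in>bits m. \<forall>y\<in>bits (L - m). \<psi> (x @ y) = (\<Sum>i<r. of_real (s i) * u i x * v i y))"

definition schmidt_rank :: "nat \<Rightarrow> nat \<Rightarrow> state \<Rightarrow> nat" where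
  "schmidt_rank L m \<psi> = (THE r. \<exists>s u v. schmidt_decomposition L m \<psi> r s u v)"

definition renyi0 :: "nat \<Rightarrow> nat \<Rightarrow> state \<Rightarrow> real" where
  "renyi0 L m \<psi> = (if m = 0 \<or> m = L then 0 else log 2 (real (schmidt_rank L m \<psi>)))"

text \<open>
  The genericity convention: every gate of the circuit increases the entropy at its bond maximally
  and changes no other entropy.
\<close>

definition generic_circuit :: "nat \<Rightarrow> gate list \<Rightarrow> bool" where
  "generic_circuit L c \<longleftrightarrow> (\<forall>later g earlier. c = later @ g # earlier \<longrightarrow>
     (let b = gate_bond g; \<psi> = circuit_state earlier; \<psi>' = apply_gate g \<psi> in
        renyi0 L b \<psi>' = 1 + min (renyi0 L (b - 1) \<psi>) (renyi0 L (b + 1) \<psi>)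
        \<and> (\<forall>n\<le>L. n \<noteq> b \<longrightarrow> renyi0 L n \<psi>' = renyi0 L n \<psi>)))"

section \<open>Right standard form\<close>

text \<open>Exchanging neighbouring gates on disjoint qubits; \<open>f\<close> gives the bond of a gate.\<close>

inductive exchange1 :: "('g \<Rightarrow> nat) \<Rightarrow> 'g list \<Rightarrow> 'g list \<Rightarrow> bool" for f where
  "f g + 2 \<le> f h \<or> f h + 2 \<le> f g \<Longrightarrow> exchange1 f (xs @ [g, h] @ ys) (xs @ [h, g] @ ys)"

definition exchange :: "('g \<Rightarrow> nat) \<Rightarrow> 'g list \<Rightarrow> 'g list \<Rightarrow> bool" where
  "exchange f = (exchange1 f)\<^sup>*\<^sup>*"

text \<open>A layout is the list of the labels \<open>(k\<^sub>i, l\<^sub>i)\<close>.\<close>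

type_synonym layout = "(nat \<times> nat) list"

definition rsf_layouts :: "nat \<Rightarrow> layout set" where
  "rsf_layouts L = {ks. 2 * length ks \<le> L
     \<and> (\<forall>(k, l)\<in>set ks. 1 \<le> k \<and> 1 \<le> l \<and> l \<le> L - k)
     \<and> successively (\<lambda>(k, _) (k', _). k + 2 \<le> k') ks}"

text \<open>The bonds of the gates, in the order of the operator product.\<close>

definition rsf_word :: "layout \<Rightarrow> nat list" where
  "rsf_word ks = concat (map (\<lambda>(k, l). rev [k..<k + l]) ks)"

definition rsf_circuit :: "nat \<Rightarrow> layout \<Rightarrow> gate list \<Rightarrow> bool" where
  "rsf_circuit L ks c \<longleftrightarrow> ks \<in> rsf_layouts L \<and> (\<forall>g\<in>set c. matchgate L g)
     \<and> exchange id (map gate_bond c) (rsf_word ks)"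

section \<open>Absorption algorithm on layouts\<close>

text \<open>\<open>New\<close> marks the gate that is being absorbed.\<close>

datatype marked_gate = New (bond: nat) | Old (bond: nat)

abbreviation same_circuit :: "marked_gate list \<Rightarrow> marked_gate list \<Rightarrow> bool" where
  "same_circuit \<equiv> exchange bond"

definition vacuum_on :: "nat set \<Rightarrow> marked_gate list \<Rightarrow> bool" where
  "vacuum_on Q earlier \<longleftrightarrow> (\<forall>g\<in>set earlier. {bond g, bond g + 1} \<inter> Q = {})"

definition multiply :: "marked_gate list \<Rightarrow> marked_gate list \<Rightarrow> bool" where
  "multiply w w' \<longleftrightarrow> (\<exists>xs q ys.
     (same_circuit w (xs @ [New q, Old q] @ ys) \<or> same_circuit w (xs @ [Old q, New q] @ ys))
     \<and> w' = xs @ [Old q] @ ys)"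

text \<open>In the following steps, \<open>j\<close> is the bond called \<open>(i - 1, i)\<close> in the usual description.\<close>

datatype step = Step1 | Step2 | Step3 | Step4

fun rewrite :: "step \<Rightarrow> marked_gate list \<Rightarrow> marked_gate list \<Rightarrow> bool" where
  "rewrite Step1 w w' = (\<exists>xs j ys.
     same_circuit w (xs @ [New j, Old (j + 1), Old j] @ ys)
     \<and> w' = xs @ [Old (j + 1), Old j, New (j + 1)] @ ys)"
| "rewrite Step2 w w' = (\<exists>xs j ys.
     same_circuit w (xs @ [New j, Old (j + 1)] @ ys) \<and> vacuum_on {j, j + 1, j + 2} ys
     \<and> w' = xs @ [Old (j + 1), New j] @ ys)"
| "rewrite Step3 w w' = (\<exists>xs j ys.
     same_circuit w (xs @ [Old j, New (j + 1)] @ ys) \<and> vacuum_on {j, j + 1, j + 2} ys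
     \<and> w' = xs @ [New (j + 1), Old j] @ ys)"
| "rewrite Step4 w w' = (\<exists>xs j ys.
     same_circuit w (xs @ [Old j, Old (j + 1), New j] @ ys)
     \<and> w' = xs @ [New (j + 1), Old j, Old (j + 1)] @ ys)"

fun step_after_rewrite :: "step \<Rightarrow> step" where
  "step_after_rewrite Step1 = Step1"
| "step_after_rewrite Step2 = Step3"
| "step_after_rewrite Step3 = Step4"
| "step_after_rewrite Step4 = Step4"

text \<open>If Step 2 or Step 3 is not applicable, the algorithm proceeds to the step after it.\<close>

fun step_after_failure :: "step \<Rightarrow> step option" where
  "step_after_failure Step1 = Some Step2"
| "step_after_failure Step2 = Some Step3"
| "step_after_failure Step3 = Some Step4"
| "step_after_failure Step4 = None"

text \<open>\<open>run s w v\<close>: the algorithm, being at step \<open>s\<close> with circuit \<open>w\<close>, can terminate with circuit \<open>v\<close>.\<close>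

inductive run :: "step \<Rightarrow> marked_gate list \<Rightarrow> marked_gate list \<Rightarrow> bool" where
  multiplied: "multiply w v \<Longrightarrow> run s w v"
| rewritten: "\<nexists>u. multiply w u \<Longrightarrow> rewrite s w w' \<Longrightarrow> run (step_after_rewrite s) w' v \<Longrightarrow> run s w v"
| continued: "\<nexists>u. multiply w u \<Longrightarrow> \<nexists>u. rewrite s w u \<Longrightarrow> step_after_failure s = Some s'
    \<Longrightarrow> run s' w v \<Longrightarrow> run s w v"
| terminated: "\<nexists>u. multiply w u \<Longrightarrow> \<nexists>u. rewrite s w u \<Longrightarrow> step_after_failure s = None \<Longrightarrow> run s w w"

definition absorbs :: "nat \<Rightarrow> nat \<Rightarrow> layout \<Rightarrow> layout \<Rightarrow> bool" where
  "absorbs L q ks ks' \<longleftrightarrow> ks' \<in> rsf_layouts L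
     \<and> (\<exists>v. run Step1 (New q # map Old (rsf_word ks)) v \<and> exchange id (map bond v) (rsf_word ks'))"

definition absorb :: "nat \<Rightarrow> nat \<Rightarrow> layout \<Rightarrow> layout" where
  "absorb L q ks = (THE ks'. absorbs L q ks ks')"

section \<open>The circuit game\<close>

definition disentangles :: "nat \<Rightarrow> nat \<Rightarrow> layout \<Rightarrow> layout \<Rightarrow> bool" where
  "disentangles L b ks ks' \<longleftrightarrow> ks' \<in> rsf_layouts L
     \<and> length (rsf_word ks) = length (rsf_word ks') + 1 \<and> absorb L b ks' = ks"

definition disentangle :: "nat \<Rightarrow> nat \<Rightarrow> layout \<Rightarrow> layout" where
  "disentangle L b ks =
     (if \<exists>ks'. disentangles L b ks ks' then THE ks'. disentangles L b ks ks' else ks)"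

definition game_step :: "nat \<Rightarrow> real \<Rightarrow> layout \<Rightarrow> layout pmf" where
  "game_step L p ks = do {
     b \<leftarrow> pmf_of_set {1..L - 1};
     d \<leftarrow> bernoulli_pmf p;
     return_pmf (if d then disentangle L b ks else absorb L b ks)
   }"

definition evolve :: "nat \<Rightarrow> real \<Rightarrow> nat \<Rightarrow> layout \<Rightarrow> layout pmf" where
  "evolve L p t ks = ((\<lambda>\<mu>. bind_pmf \<mu> (game_step L p)) ^^ t) (return_pmf ks)"

text \<open>
  The stationary distribution is the invariant distribution to which the chain converges from every
  initial layout.
\<close>

definition is_stationary_distribution :: "nat \<Rightarrow> real \<Rightarrow> layout pmf \<Rightarrow> bool" where
  "is_stationary_distribution L p \<pi> \<longleftrightarrow>
     set_pmf \<pi> \<subseteq> rsf_layouts L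
     \<and> bind_pmf \<pi> (game_step L p) = \<pi>
     \<and> (\<forall>ks\<in>rsf_layouts L. \<forall>ks'. (\<lambda>t. pmf (evolve L p t ks) ks') \<longlonglongrightarrow> pmf \<pi> ks')"

definition stationary_distribution :: "nat \<Rightarrow> real \<Rightarrow> layout pmf" where
  "stationary_distribution L p = (THE \<pi>. is_stationary_distribution L p \<pi>)"

text \<open>
  A random circuit, with its layout, as it occurs in the stationary game: the layout follows the
  stationary distribution, and the gates are arbitrary subject to the genericity convention.
\<close>

definition stationary_random_circuit ::
    "nat \<Rightarrow> real \<Rightarrow> 'w measure \<Rightarrow> ('w \<Rightarrow> layout) \<Rightarrow> ('w \<Rightarrow> gate list) \<Rightarrow> bool" where
  "stationary_random_circuit L p M lay circ \<longleftrightarrow>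
     lay \<in> measurable M (count_space UNIV)
     \<and> distr M (count_space UNIV) lay = measure_pmf (stationary_distribution L p)
     \<and> (\<forall>\<omega>\<in>space M. rsf_circuit L (lay \<omega>) (circ \<omega>) \<and> generic_circuit L (circ \<omega>))"

end

theory Submission
  imports Defs
begin

text \<open>
  A word of bonds acts on the involutions of \<open>{1..L}\<close> by \<open>w \<mapsto> s * w * s\<close>, products being taken in the
  0-Hecke monoid. Merging two equal gates, the braid moves, and the moves on the vacuum preserve the
  resulting involution (the last because disjoint fixed points commute with everything), and
  right standard forms correspond bijectively to involutions. Hence the result of an absorption is
  determined by its involution, and it remains to run the algorithm. Each bond then pairs up the
  layouts: at \<open>p = 1/2\<close> a step stays put with probability \<open>1/2\<close> and otherwise moves to the partner
  at a random bond, so the uniform distribution is stationary. Finally \<open>S\<^sub>m\<close> counts the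
  2-cycles \<open>(i j)\<close> with \<open>i \<le> m < j\<close>, and each such pair is a 2-cycle of \<open>T(L - 2)\<close> of the
  \<open>T(L)\<close> involutions.
\<close>

section \<open>Involutions and the 0-Hecke action\<close>

text \<open>\<open>absorb\<close> is a definite description over runs that may use any
  representative of an exchange class. The invariant gives uniqueness without comparing runs, so for
  existence it is enough to exhibit one run for each layout and bond. That run also shows that the
  layout either stays the same or gains exactly one gate, which is what the disentangler tests.
  Exhibiting it is mostly negative work: a step may be skipped, or a merge passed over, only after
  showing that no representative of the class permits it. For this the order of the gates on two
  neighbouring bonds, which no exchange can alter, is tracked by \<open>proj\<close>. The 0-Hecke
  product takes the place of the group product because merging two gates on a bond must be
  idempotent.\<close>

abbreviation adj_swap :: "nat \<Rightarrow> nat \<Rightarrow> nat" where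
  "adj_swap b \<equiv> Transposition.transpose b (Suc b)"

text \<open>Demazure product with a simple transposition: at an ascent the product has one inversion
  more; a product that would shorten is skipped, which makes each generator idempotent.\<close>

definition rmul :: "nat \<Rightarrow> (nat \<Rightarrow> nat) \<Rightarrow> nat \<Rightarrow> nat" where
  "rmul b w = (if w b < w (Suc b) then w \<circ> adj_swap b else w)"

text \<open>Seen through the inverse, so that the relations for left factors are inherited from
  \<open>rmul\<close>.\<close>

definition lmul :: "nat \<Rightarrow> (nat \<Rightarrow> nat) \<Rightarrow> nat \<Rightarrow> nat" where
  "lmul b w = inv (rmul b (inv w))"

definition hecke :: "nat \<Rightarrow> (nat \<Rightarrow> nat) \<Rightarrow> nat \<Rightarrow> nat" where
  "hecke b w = lmul b (rmul b w)"

lemma bij_rmul: "bij w \<Longrightarrow> bij (rmul b w)"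
  by (auto simp: rmul_def intro!: bij_comp)

lemma bij_lmul: "bij w \<Longrightarrow> bij (lmul b w)"
  by (simp add: lmul_def bij_rmul bij_imp_bij_inv)

lemma lmul_eq:
  assumes "bij w"
  shows "lmul b w = (if inv w b < inv w (Suc b) then adj_swap b \<circ> w else w)"
proof -
  have "inv (inv w \<circ> adj_swap b) = adj_swap b \<circ> w"
    using assms by (subst o_inv_distrib) (auto simp: bij_imp_bij_inv inv_inv_eq)
  then show ?thesis
    using assms by (simp add: lmul_def rmul_def inv_inv_eq)
qed

lemma rmul_idem: "rmul b (rmul b w) = rmul b w"
  by (auto simp: rmul_def)

lemma rmul_commute: "b + 2 \<le> c \<or> c + 2 \<le> b \<Longrightarrow> rmul b (rmul c w) = rmul c (rmul b w)"
  by (auto simp: rmul_def fun_eq_iff Transposition.transpose_def)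

lemma rmul_braid: "rmul b (rmul (Suc b) (rmul b w)) = rmul (Suc b) (rmul b (rmul (Suc b) w))"
  by (auto simp: rmul_def fun_eq_iff Transposition.transpose_def)

lemma lmul_idem: "bij w \<Longrightarrow> lmul b (lmul b w) = lmul b w"
  by (simp add: lmul_def inv_inv_eq bij_rmul bij_imp_bij_inv rmul_idem)

lemma lmul_commute:
  "bij w \<Longrightarrow> b + 2 \<le> c \<or> c + 2 \<le> b \<Longrightarrow> lmul b (lmul c w) = lmul c (lmul b w)"
  by (simp add: lmul_def inv_inv_eq bij_rmul bij_imp_bij_inv rmul_commute[of b c])

lemma lmul_braid:
  "bij w \<Longrightarrow> lmul b (lmul (Suc b) (lmul b w)) = lmul (Suc b) (lmul b (lmul (Suc b) w))"
  by (simp add: lmul_def inv_inv_eq bij_rmul bij_imp_bij_inv rmul_braid)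

lemma adj_swap_less_iff:
  assumes "{x, y} \<noteq> {b, Suc b}"
  shows "adj_swap b x < adj_swap b y \<longleftrightarrow> x < y"
  using assms by (auto simp: Transposition.transpose_def)

text \<open>Swapping the values \<open>b\<close>, \<open>Suc b\<close> affects the ascent test at
  \<open>c\<close>, \<open>Suc c\<close> only if exactly these values stand there. Commutation of
  the two sides is what lets their relations combine to relations for \<open>hecke\<close>.\<close>

lemma lmul_rmul:
  assumes w: "bij w"
  shows "lmul b (rmul c w) = rmul c (lmul b w)"
proof -
  let ?s = "adj_swap b" and ?t = "adj_swap c"
  have inv_wt: "inv (w \<circ> ?t) = ?t \<circ> inv w"
    using w by (subst o_inv_distrib) auto
  have inv_w: "inv w x = y \<longleftrightarrow> w y = x" for x y
    using w by (metis bij_inv_eq_iff)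
  show ?thesis
  proof (cases "{w c, w (Suc c)} = {b, Suc b}")
    case False
    then have "{inv w b, inv w (Suc b)} \<noteq> {c, Suc c}"
      using inv_w by (auto simp: doubleton_eq_iff)
    then show ?thesis
      using False w by (auto simp: lmul_eq bij_rmul rmul_def inv_wt adj_swap_less_iff
          comp_assoc bij_comp)
  next
    case True
    then consider "w c = b" "w (Suc c) = Suc b" | "w c = Suc b" "w (Suc c) = b"
      by (auto simp: doubleton_eq_iff)
    then show ?thesis
    proof cases
      \<comment> \<open>Left and right swap agree as permutations here, and whichever acts first
        removes the ascent for the other.\<close>
      case 1
      then have "inv w b = c" "inv w (Suc b) = Suc c" by (auto simp: inv_w)
      moreover have "w x = b \<longleftrightarrow> x = c" "w x = Suc b \<longleftrightarrow> x = Suc c" for x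
        using 1 inv_w by metis+
      then have "?s \<circ> w = w \<circ> ?t"
        by (auto simp: fun_eq_iff Transposition.transpose_def 1)
      ultimately show ?thesis
        using w 1 by (auto simp: lmul_eq bij_rmul rmul_def inv_wt bij_comp)
    next
      case 2
      then have "inv w b = Suc c" "inv w (Suc b) = c" by (auto simp: inv_w)
      then show ?thesis using w 2 by (auto simp: lmul_eq rmul_def)
    qed
  qed
qed

lemma hecke_idem: "bij w \<Longrightarrow> hecke b (hecke b w) = hecke b w"
  by (simp add: hecke_def lmul_rmul[symmetric] lmul_idem rmul_idem bij_rmul)

lemma hecke_commute:
  "bij w \<Longrightarrow> b + 2 \<le> c \<or> c + 2 \<le> b \<Longrightarrow> hecke b (hecke c w) = hecke c (hecke b w)"
  by (simp add: hecke_def lmul_rmul[symmetric] lmul_commute[of _ b c] rmul_commute[of b c] bij_rmul)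

lemma hecke_braid:
  "bij w \<Longrightarrow> hecke b (hecke (Suc b) (hecke b w)) = hecke (Suc b) (hecke b (hecke (Suc b) w))"
  by (simp add: hecke_def lmul_rmul[symmetric] lmul_braid rmul_braid bij_rmul bij_lmul)

section \<open>Involutions and their pairing by a simple transposition\<close>

definition involutions_on :: "nat set \<Rightarrow> (nat \<Rightarrow> nat) set" where
  "involutions_on A = {w. w permutes A \<and> (\<forall>x. w (w x) = x)}"

text \<open>The test says that \<open>w\<close> commutes with the swap. Conjugation would then do
  nothing, so multiplication takes its place; this is the Richardson-Springer move on
  involutions.\<close>

definition partner :: "nat \<Rightarrow> (nat \<Rightarrow> nat) \<Rightarrow> nat \<Rightarrow> nat" where
  "partner b w = (let s = adj_swap b in
     if {w b, w (Suc b)} = {b, Suc b} then w \<circ> s else s \<circ> w \<circ> s)"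

lemma involution_bij: "\<forall>x. w (w x) = x \<Longrightarrow> bij (w :: nat \<Rightarrow> nat)"
  by (rule o_bij[of w]) (auto simp: fun_eq_iff)

lemma involution_inv: "\<forall>x. w (w x) = x \<Longrightarrow> inv (w :: nat \<Rightarrow> nat) = w"
  by (rule inv_equality) auto

text \<open>After right multiplication at an ascent, the left factor tests
  \<open>adj_swap b (w b) < adj_swap b (w (Suc b))\<close>. The swap preserves the order of these
  values unless \<open>w\<close> fixes both points, and only then does the left factor do
  nothing.\<close>

lemma hecke_eq_partner:
  assumes "\<forall>x. w (w x) = x"
  shows "hecke b w = (if w b < w (Suc b) then partner b w else w)"
proof -
  let ?s = "adj_swap b"
  note bij = involution_bij[OF assms] and inv = involution_inv[OF assms]
  have inv_ws: "inv (w \<circ> ?s) = ?s \<circ> w"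
    using bij inv by (subst o_inv_distrib) auto
  show ?thesis
  proof (cases "w b < w (Suc b)")
    case True
    show ?thesis
    proof (cases "{w b, w (Suc b)} = {b, Suc b}")
      case True
      with \<open>w b < w (Suc b)\<close> have "w b = b" "w (Suc b) = Suc b" by (auto simp: doubleton_eq_iff)
      then show ?thesis
        using bij inv_ws by (auto simp: hecke_def rmul_def lmul_eq bij_comp partner_def)
    next
      case False
      then show ?thesis
        using True bij inv_ws
        by (auto simp: hecke_def rmul_def lmul_eq bij_comp partner_def adj_swap_less_iff comp_assoc Let_def)
    qed
  next
    case False
    then show ?thesis using bij inv by (simp add: hecke_def rmul_def lmul_eq)
  qed
qed

lemma partner_involution_iff:
  assumes "\<forall>x. w (w x) = x"
  shows "\<forall>x. partner b w (partner b w x) = x"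
proof (cases "{w b, w (Suc b)} = {b, Suc b}")
  case True
  have "\<And>x y. w x = w y \<longleftrightarrow> x = y" using assms by metis
  moreover have "\<And>x y. w x = y \<longleftrightarrow> x = w y" using assms by metis
  ultimately show ?thesis using True assms
    by (auto simp: partner_def Transposition.transpose_def doubleton_eq_iff)
next
  case False
  then show ?thesis using assms by (auto simp: partner_def Let_def)
qed

lemma partner_permutes:
  assumes "w permutes A" "b \<in> A" "Suc b \<in> A"
  shows "partner b w permutes A"
  using assms by (auto simp: partner_def Let_def intro!: permutes_compose permutes_swap_id)

lemma partner_in_involutions_on:
  "w \<in> involutions_on A \<Longrightarrow> b \<in> A \<Longrightarrow> Suc b \<in> A \<Longrightarrow> partner b w \<in> involutions_on A"
  by (simp add: involutions_on_def partner_permutes partner_involution_iff)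

lemma hecke_in_involutions_on:
  "w \<in> involutions_on A \<Longrightarrow> b \<in> A \<Longrightarrow> Suc b \<in> A \<Longrightarrow> hecke b w \<in> involutions_on A"
  using partner_in_involutions_on[of w A b] by (simp add: involutions_on_def hecke_eq_partner)

text \<open>Both forms of \<open>partner\<close> reverse the order of the two values, so of two
  partners exactly one has an ascent at \<open>b\<close>. Absorption leads from that one to the
  other, and the disentangler leads back.\<close>

lemma partner_ascent_iff:
  assumes "\<forall>x. w (w x) = x"
  shows "partner b w b < partner b w (Suc b) \<longleftrightarrow> \<not> w b < w (Suc b)"
proof -
  have "w b \<noteq> w (Suc b)" using assms by (metis n_not_Suc_n)
  then show ?thesis
    by (cases "{w b, w (Suc b)} = {b, Suc b}")
      (auto simp: partner_def Let_def adj_swap_less_iff insert_commute)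
qed

lemma partner_commuting: "{w b, w (Suc b)} = {b, Suc b} \<Longrightarrow> partner b w = w \<circ> adj_swap b"
  and partner_conjugate: "{w b, w (Suc b)} \<noteq> {b, Suc b} \<Longrightarrow> partner b w = adj_swap b \<circ> w \<circ> adj_swap b"
  unfolding partner_def Let_def by (rule if_P if_not_P, assumption)+

lemma partner_partner: "partner b (partner b w) = w"
proof (cases "{w b, w (Suc b)} = {b, Suc b}")
  case True
  have p: "partner b w = w \<circ> adj_swap b" using True by (rule partner_commuting)
  from True have "{(w \<circ> adj_swap b) b, (w \<circ> adj_swap b) (Suc b)} = {b, Suc b}" by auto
  then have "partner b (w \<circ> adj_swap b) = w \<circ> adj_swap b \<circ> adj_swap b" by (rule partner_commuting)
  also have "\<dots> = w" by (rule ext) simp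
  finally show ?thesis unfolding p .
next
  case False
  have p: "partner b w = adj_swap b \<circ> w \<circ> adj_swap b" using False by (rule partner_conjugate)
  let ?v = "adj_swap b \<circ> w \<circ> adj_swap b"
  have "{?v b, ?v (Suc b)} \<noteq> {b, Suc b}"
  proof
    assume "{?v b, ?v (Suc b)} = {b, Suc b}"
    then have "adj_swap b ` {?v b, ?v (Suc b)} = adj_swap b ` {b, Suc b}" by (rule arg_cong)
    then show False using False by (simp add: insert_commute)
  qed
  then have "partner b ?v = adj_swap b \<circ> ?v \<circ> adj_swap b" by (rule partner_conjugate)
  also have "\<dots> = w" by (rule ext) simp
  finally show ?thesis unfolding p .
qed

text \<open>When the action moves an involution, the source can be recovered from the result; this
  makes the target of the disentangler unique.\<close>

lemma hecke_ne_imp_partner: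
  assumes "\<forall>x. w (w x) = x" "hecke b w \<noteq> w"
  shows "w = partner b (hecke b w)" "\<not> hecke b w b < hecke b w (Suc b)"
  using assms by (auto simp: hecke_eq_partner partner_partner partner_ascent_iff split: if_splits)

section \<open>Involutions of words of bonds\<close>

definition word_perm :: "nat list \<Rightarrow> nat \<Rightarrow> nat" where
  "word_perm bs = foldr hecke bs id"

lemma word_perm_Nil [simp]: "word_perm [] = id"
  and word_perm_Cons [simp]: "word_perm (b # bs) = hecke b (word_perm bs)"
  by (simp_all add: word_perm_def)

lemma word_perm_append: "word_perm (xs @ ys) = foldr hecke xs (word_perm ys)"
  by (simp add: word_perm_def)

lemma word_perm_in_involutions_on:
  "\<forall>b\<in>set bs. b \<in> A \<and> Suc b \<in> A \<Longrightarrow> word_perm bs \<in> involutions_on A"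
  by (induction bs) (auto simp: hecke_in_involutions_on, simp add: involutions_on_def permutes_def)

lemma bij_word_perm: "bij (word_perm bs)"
  using word_perm_in_involutions_on[of bs UNIV] by (auto simp: involutions_on_def intro: involution_bij)

text \<open>Bonds that avoid \<open>x\<close> act within the involutions of \<open>- {x}\<close>, so
  untouched qubits are fixed points.\<close>

lemma word_perm_vacuum:
  assumes "\<forall>b\<in>set bs. b \<noteq> x \<and> Suc b \<noteq> x"
  shows "word_perm bs x = x"
  using word_perm_in_involutions_on[of bs "- {x}"] assms
  by (auto simp: involutions_on_def permutes_def)

lemma transpose_commute_fixed:
  assumes "bij w" "w a = a" "w b = b"
  shows "Transposition.transpose a b \<circ> w = w \<circ> Transposition.transpose a b"
proof -
  have inj: "\<And>x y. w x = w y \<longleftrightarrow> x = y" using assms(1) by (auto simp: bij_def inj_eq)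
  have "w x = a \<longleftrightarrow> x = a" "w x = b \<longleftrightarrow> x = b" for x
    using inj[of x a] inj[of x b] assms(2,3) by auto
  then show ?thesis by (auto simp: fun_eq_iff Transposition.transpose_def assms(2,3))
qed

text \<open>The first action joins two adjacent fixed points, the second moves one end of this
  2-cycle. Either order yields the 2-cycle of \<open>b\<close> and \<open>Suc (Suc b)\<close>,
  because \<open>w\<close> commutes with both swaps and these satisfy the braid relation.\<close>

lemma hecke_vacuum:
  assumes inv: "\<forall>x. w (w x) = x" and "w b = b" "w (Suc b) = Suc b" "w (Suc (Suc b)) = Suc (Suc b)"
  shows "hecke b (hecke (Suc b) w) = hecke (Suc b) (hecke b w)"
proof -
  let ?s = "adj_swap b" and ?t = "adj_swap (Suc b)"
  have 1: "hecke (Suc b) w = w \<circ> ?t" "hecke b w = w \<circ> ?s"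
    using assms by (auto simp: hecke_eq_partner partner_def)
  have 2: "\<forall>x. (w \<circ> ?t) ((w \<circ> ?t) x) = x" "\<forall>x. (w \<circ> ?s) ((w \<circ> ?s) x) = x"
    using partner_involution_iff[OF inv, of "Suc b"] partner_involution_iff[OF inv, of b] assms
    by (auto simp: partner_def Let_def)
  have 3: "hecke b (w \<circ> ?t) = ?s \<circ> (w \<circ> ?t) \<circ> ?s" "hecke (Suc b) (w \<circ> ?s) = ?t \<circ> (w \<circ> ?s) \<circ> ?t"
    using assms by (auto simp: hecke_eq_partner[OF 2(1)] hecke_eq_partner[OF 2(2)] partner_def doubleton_eq_iff Let_def)
  have 4: "?s \<circ> w = w \<circ> ?s" "?t \<circ> w = w \<circ> ?t"
    using assms transpose_commute_fixed[OF involution_bij] by auto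
  have "?s \<circ> (?t \<circ> ?s) = ?t \<circ> (?s \<circ> ?t)" by (auto simp: fun_eq_iff Transposition.transpose_def)
  then show ?thesis using 3 4 1 by (metis comp_assoc)
qed

section \<open>Exchange classes and RSF words\<close>

lemma exchange_refl [simp]: "exchange f xs xs"
  by (simp add: exchange_def)

lemma exchange_trans [trans]: "exchange f xs ys \<Longrightarrow> exchange f ys zs \<Longrightarrow> exchange f xs zs"
  by (simp add: exchange_def)

lemma exchange1_sym: "exchange1 f xs ys \<Longrightarrow> exchange1 f ys xs"
  by (auto elim!: exchange1.cases intro!: exchange1.intros)

lemma exchange_sym: "exchange f xs ys \<Longrightarrow> exchange f ys xs"
  unfolding exchange_def by (metis exchange1_sym symp_def symp_rtranclp)

lemma exchange1_context: "exchange1 f xs ys \<Longrightarrow> exchange1 f (as @ xs @ bs) (as @ ys @ bs)"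
  by (elim exchange1.cases) (metis append_assoc exchange1.intros)

lemma exchange_context:
  assumes "exchange f xs ys"
  shows "exchange f (as @ xs @ bs) (as @ ys @ bs)"
  using assms unfolding exchange_def
  by (induction rule: rtranclp_induct) (auto dest: exchange1_context[of f _ _ as bs])

lemma exchange_move:
  assumes "\<forall>g\<in>set ys. f g + 2 \<le> f h \<or> f h + 2 \<le> f g"
  shows "exchange f (h # ys) (ys @ [h])"
  using assms
proof (induction ys)
  case (Cons g ys)
  have "exchange1 f ([] @ [h, g] @ ys) ([] @ [g, h] @ ys)"
    using Cons.prems by (intro exchange1.intros) auto
  then have "exchange f (h # g # ys) (g # h # ys)" by (simp add: exchange_def)
  also have "exchange f \<dots> (g # ys @ [h])"
    using exchange_context[OF Cons.IH, of "[g]" "[]"] Cons.prems by auto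
  finally show ?case by simp
qed simp

lemma exchange1_map:
  assumes "exchange1 (f \<circ> h) xs ys"
  shows "exchange1 f (map h xs) (map h ys)"
  using assms
proof cases
  case (1 g g' as bs)
  then show ?thesis using exchange1.intros[of f "h g" "h g'" "map h as" "map h bs"] by simp
qed

lemma exchange_map:
  assumes "exchange (f \<circ> h) xs ys"
  shows "exchange f (map h xs) (map h ys)"
  using assms unfolding exchange_def
proof (induction rule: rtranclp_induct)
  case (step ys zs)
  show ?case by (rule rtranclp.rtrancl_into_rtrancl[OF step.IH exchange1_map[OF step(2)]])
qed simp

lemma exchange_invariant:
  assumes "exchange f xs ys" "\<And>xs ys. exchange1 f xs ys \<Longrightarrow> P xs = P ys"
  shows "P xs = P ys"
  using assms(1) unfolding exchange_def
  by (induction rule: rtranclp_induct) (simp_all add: assms(2))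

lemma exchange_set: "exchange f xs ys \<Longrightarrow> set xs = set ys"
  by (erule exchange_invariant) (elim exchange1.cases, auto)

text \<open>Two gates on bonds from \<open>{i, Suc i}\<close> share a qubit, so no exchange reorders
  them. The invariant excludes a pattern in all representatives of a class at once.\<close>

lemma exchange_filter:
  "exchange f xs ys \<Longrightarrow>
    filter (\<lambda>g. f g = i \<or> f g = Suc i) xs = filter (\<lambda>g. f g = i \<or> f g = Suc i) ys"
  by (erule exchange_invariant) (elim exchange1.cases, auto)

lemma exchange_word_perm: "exchange id xs ys \<Longrightarrow> word_perm xs = word_perm ys"
  by (erule exchange_invariant)
    (elim exchange1.cases, auto simp: word_perm_append hecke_commute bij_word_perm)

lemma exchange_bonds: "same_circuit w w' \<Longrightarrow> exchange id (map bond w) (map bond w')"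
  by (rule exchange_map) simp

section \<open>Words restricted to two neighbouring bonds\<close>

definition proj :: "nat \<Rightarrow> nat list \<Rightarrow> nat list" where
  "proj i = filter (\<lambda>b. b = i \<or> b = Suc i)"

lemma proj_simps [simp]:
  "proj i [] = []"
  "proj i (b # bs) = (if b = i \<or> b = Suc i then b # proj i bs else proj i bs)"
  "proj i (bs @ cs) = proj i bs @ proj i cs"
  by (simp_all add: proj_def)

lemma exchange_proj: "exchange id xs ys \<Longrightarrow> proj i xs = proj i ys"
  unfolding proj_def using exchange_filter[of id] by auto

lemma proj_eq_Nil: "i \<notin> set bs \<Longrightarrow> Suc i \<notin> set bs \<Longrightarrow> proj i bs = []"
  by (induction bs) auto

lemma set_proj: "set (proj i bs) = set bs \<inter> {i, Suc i}"
  by (auto simp: proj_def)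

lemma proj_descending:
  "proj i (rev [k..<k + l]) =
     (if k \<le> Suc i \<and> Suc i < k + l then [Suc i] else []) @ (if k \<le> i \<and> i < k + l then [i] else [])"
  by (induction l) auto

section \<open>Invariance of the involution along a run\<close>

lemma multiply_word_perm: "multiply w v \<Longrightarrow> word_perm (map bond v) = word_perm (map bond w)"
  unfolding multiply_def
  by (auto dest!: exchange_bonds[THEN exchange_word_perm]
      simp: word_perm_append hecke_idem bij_word_perm)

lemma hecke_word_vacuum:
  assumes "vacuum_on {j, j + 1, j + 2} ys"
  shows "hecke j (hecke (Suc j) (word_perm (map bond ys))) =
    hecke (Suc j) (hecke j (word_perm (map bond ys)))"
proof (rule hecke_vacuum)
  show "\<forall>x. word_perm (map bond ys) (word_perm (map bond ys) x) = x"
    using word_perm_in_involutions_on[of _ UNIV] by (auto simp: involutions_on_def)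
qed (use assms in \<open>auto intro!: word_perm_vacuum simp: vacuum_on_def\<close>)

lemma rewrite_word_perm:
  assumes "rewrite s w v"
  shows "word_perm (map bond v) = word_perm (map bond w)"
proof -
  have cong: "word_perm (map bond w) = word_perm (map bond w')" if "same_circuit w w'" for w'
    using that by (rule exchange_word_perm[OF exchange_bonds])
  show ?thesis
  proof (cases s)
    case Step1
    with assms obtain xs j ys where *: "same_circuit w (xs @ [New j, Old (j + 1), Old j] @ ys)"
      "v = xs @ [Old (j + 1), Old j, New (j + 1)] @ ys" by auto
    show ?thesis unfolding cong[OF *(1)] *(2) by (simp add: word_perm_append hecke_braid bij_word_perm)
  next
    case Step2
    with assms obtain xs j ys where *: "same_circuit w (xs @ [New j, Old (j + 1)] @ ys)"
      "vacuum_on {j, j + 1, j + 2} ys" "v = xs @ [Old (j + 1), New j] @ ys" by auto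
    show ?thesis unfolding cong[OF *(1)] *(3) by (simp add: word_perm_append hecke_word_vacuum[OF *(2)])
  next
    case Step3
    with assms obtain xs j ys where *: "same_circuit w (xs @ [Old j, New (j + 1)] @ ys)"
      "vacuum_on {j, j + 1, j + 2} ys" "v = xs @ [New (j + 1), Old j] @ ys" by auto
    show ?thesis unfolding cong[OF *(1)] *(3) by (simp add: word_perm_append hecke_word_vacuum[OF *(2)])
  next
    case Step4
    with assms obtain xs j ys where *: "same_circuit w (xs @ [Old j, Old (j + 1), New j] @ ys)"
      "v = xs @ [New (j + 1), Old j, Old (j + 1)] @ ys" by auto
    show ?thesis unfolding cong[OF *(1)] *(2) by (simp add: word_perm_append hecke_braid bij_word_perm)
  qed
qed

lemma run_word_perm: "run s w v \<Longrightarrow> word_perm (map bond v) = word_perm (map bond w)"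
proof (induction rule: run.induct)
  case (multiplied w v s)
  then show ?case by (rule multiply_word_perm)
next
  case (rewritten w s w' v)
  then show ?case using rewrite_word_perm[of s w w'] by (simp only:)
next
  case terminated
  show ?case by (rule refl)
qed

lemma exchange_cong:
  assumes "exchange f w w'"
  shows "exchange f w v \<longleftrightarrow> exchange f w' v"
  using exchange_trans[OF assms] exchange_trans[OF exchange_sym[OF assms]] by (rule iffI[rotated])

lemma multiply_cong:
  assumes "same_circuit w w'"
  shows "multiply w u \<longleftrightarrow> multiply w' u"
  unfolding multiply_def exchange_cong[OF assms] ..

lemma rewrite_cong:
  assumes "same_circuit w w'"
  shows "rewrite s w u \<longleftrightarrow> rewrite s w' u"
  by (cases s) (simp_all only: rewrite.simps exchange_cong[OF assms])

text \<open>All tests and rewrites see only the exchange class. A run that stops without merging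
  returns its own input, however, so the results agree only up to exchange.\<close>

lemma run_cong:
  assumes "run s w v" "same_circuit w w'"
  shows "\<exists>v'. run s w' v' \<and> same_circuit v v'"
  using assms
proof (induction arbitrary: w' rule: run.induct)
  case (multiplied w v s)
  then have "multiply w' v" by (simp only: multiply_cong)
  then show ?case using run.multiplied exchange_refl by blast
next
  case (rewritten w s u v)
  note eqs = multiply_cong[OF rewritten.prems] rewrite_cong[OF rewritten.prems]
  have "run s w' v" using rewritten.hyps(1-3) unfolding eqs by (rule run.rewritten)
  then show ?case using exchange_refl by blast
next
  case (continued w s s' v)
  note eqs = multiply_cong[OF continued.prems] rewrite_cong[OF continued.prems]
  from continued.IH[OF continued.prems] obtain v' where v': "run s' w' v'" "same_circuit v v'" by blast
  have "run s w' v'" using continued.hyps(1-3) v'(1) unfolding eqs by (rule run.continued)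
  with v'(2) show ?case by blast
next
  case (terminated w s)
  note eqs = multiply_cong[OF terminated.prems] rewrite_cong[OF terminated.prems]
  have "run s w' w'" using terminated.hyps unfolding eqs by (rule run.terminated)
  with terminated.prems show ?case by blast
qed

text \<open>A recursive form of the RSF conditions; the lower bound \<open>lo\<close> makes it apply
  to suffixes of layouts, and the sum \<open>k + l\<close> avoids the truncated
  \<open>L - k\<close>.\<close>

fun spaced :: "nat \<Rightarrow> nat \<Rightarrow> layout \<Rightarrow> bool" where
  "spaced lo L [] = True"
| "spaced lo L ((k, l) # ks) = (lo \<le> k \<and> 1 \<le> l \<and> k + l \<le> L \<and> spaced (k + 2) L ks)"

text \<open>The least start allowed for a further chain; with it \<open>spaced\<close> splits over
  concatenation.\<close>

fun next_start :: "nat \<Rightarrow> layout \<Rightarrow> nat" where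
  "next_start lo [] = lo"
| "next_start lo ((k, l) # ks) = next_start (k + 2) ks"

lemma next_start_snoc [simp]: "next_start lo (ks @ [(k, l)]) = k + 2"
  by (induction ks arbitrary: lo) auto

lemma spaced_append: "spaced lo L (xs @ ys) \<longleftrightarrow> spaced lo L xs \<and> spaced (next_start lo xs) L ys"
  by (induction xs arbitrary: lo) auto

lemma spaced_mono: "spaced lo L ks \<Longrightarrow> lo' \<le> lo \<Longrightarrow> spaced lo' L ks"
  by (cases ks) auto

lemma next_start_ge: "spaced lo L ks \<Longrightarrow> lo \<le> next_start lo ks"
proof (induction ks arbitrary: lo)
  case (Cons x ks)
  then show ?case by (cases x) fastforce
qed simp

lemma spaced_length: "spaced lo L ks \<Longrightarrow> 1 \<le> lo \<Longrightarrow> ks \<noteq> [] \<Longrightarrow> 2 * length ks + lo \<le> L + 1"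
proof (induction ks arbitrary: lo)
  case (Cons x ks)
  then show ?case by (cases x; cases "ks = []") fastforce+
qed simp

lemma spaced_iff:
  "spaced lo L ks \<longleftrightarrow> (\<forall>(k, l)\<in>set ks. lo \<le> k \<and> 1 \<le> l \<and> k + l \<le> L)
     \<and> successively (\<lambda>(k, _) (k', _). k + 2 \<le> k') ks"
proof (induction ks arbitrary: lo)
  case (Cons x ks)
  obtain k l where x: "x = (k, l)" by force
  show ?case
  proof (cases ks)
    case Nil
    then show ?thesis by (simp add: x)
  next
    case (Cons y ks')
    then show ?thesis
      using Cons.IH[of "k + 2"] Cons.IH[of lo] by (cases y) (auto simp: x)
  qed
qed simp

lemma rsf_layouts_eq: "rsf_layouts L = {ks. spaced 1 L ks}"
proof -
  have "1 \<le> l \<and> l \<le> L - k \<longleftrightarrow> 1 \<le> l \<and> k + l \<le> L" for k l by auto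
  moreover have "2 * length ks \<le> L" if "spaced 1 L ks" for ks
    using spaced_length[OF that] by (cases "ks = []") auto
  ultimately show ?thesis by (auto simp: rsf_layouts_def spaced_iff)
qed

lemma rsf_word_simps [simp]:
  "rsf_word [] = []"
  "rsf_word ((k, l) # ks) = rev [k..<k + l] @ rsf_word ks"
  "rsf_word (ks @ ks') = rsf_word ks @ rsf_word ks'"
  by (simp_all add: rsf_word_def)

lemma rsf_word_bounds: "spaced lo L ks \<Longrightarrow> b \<in> set (rsf_word ks) \<Longrightarrow> lo \<le> b \<and> b < L"
  by (induction lo L ks rule: spaced.induct) force+

lemma proj_rsf_word_Nil: "spaced lo L ks \<Longrightarrow> Suc i < lo \<Longrightarrow> proj i (rsf_word ks) = []"
  by (rule proj_eq_Nil) (auto dest: rsf_word_bounds)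

text \<open>A chain that contributes \<open>Suc i\<close> without \<open>i\<close> starts at
  \<open>Suc i\<close>, and the chains listed after it start at \<open>i + 3\<close> or
  above.\<close>

lemma proj_rsf_word_no_repeat:
  "spaced lo L ks \<Longrightarrow> successively (\<lambda>a b. \<not> (a = Suc i \<and> b = Suc i)) (proj i (rsf_word ks))"
proof (induction ks arbitrary: lo)
  case (Cons x ks)
  then show ?case
    by (cases x) (auto simp: proj_descending successively_append_iff successively_Cons proj_rsf_word_Nil)
qed simp

text \<open>The end of the list acts first. If the earliest gate on the bonds \<open>i\<close>,
  \<open>Suc i\<close> is on \<open>Suc i\<close>, its chain starts there, and no chain listed after
  it reaches down to \<open>Suc (Suc i)\<close>.\<close>

lemma proj_rsf_word_last:
  "spaced lo L ks \<Longrightarrow> proj i (rsf_word ks) \<noteq> [] \<Longrightarrow> last (proj i (rsf_word ks)) = Suc i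
    \<Longrightarrow> proj (Suc i) (rsf_word ks) \<noteq> [] \<and> last (proj (Suc i) (rsf_word ks)) = Suc i"
proof (induction ks arbitrary: lo)
  case (Cons x ks)
  obtain k l where x: "x = (k, l)" by force
  have sp: "spaced (k + 2) L ks" "1 \<le> l" using Cons.prems x by auto
  show ?case
  proof (cases "proj i (rsf_word ks) = []")
    case True
    then have k: "k = Suc i" using Cons.prems(2,3) by (auto simp: x proj_descending split: if_splits)
    then have "proj (Suc i) (rsf_word ks) = []" using sp
      by (intro proj_rsf_word_Nil) auto
    moreover have "proj (Suc i) (rev [k..<k + l]) \<noteq> [] \<and> last (proj (Suc i) (rev [k..<k + l])) = Suc i"
      unfolding proj_descending using k sp by auto
    ultimately show ?thesis by (simp add: x)
  next
    case False
    then show ?thesis using Cons.IH[OF sp(1)] Cons.prems by (auto simp: x)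
  qed
qed simp

text \<open>Under the bound all chains start at \<open>i\<close> or below, so a chain containing
  \<open>Suc i\<close> continues down to \<open>i\<close>.\<close>

lemma proj_rsf_word_tail:
  "spaced lo L ks \<Longrightarrow> next_start lo ks \<le> i + 2 \<Longrightarrow>
    proj i (rsf_word ks) = [] \<or> last (proj i (rsf_word ks)) = i"
proof (induction ks arbitrary: lo)
  case (Cons x ks)
  obtain k l where x: "x = (k, l)" by force
  then have sp: "spaced (k + 2) L ks" "next_start (k + 2) ks \<le> i + 2" using Cons.prems by auto
  then have "k \<le> i" using next_start_ge by fastforce
  then show ?case using Cons.IH[OF sp] by (auto simp: x proj_descending)
qed simp

lemma rsf_no_pair:
  assumes "spaced 1 L ks" "exchange id u (rsf_word ks)"
  shows "u \<noteq> xs @ [j, j] @ ys"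
proof
  assume u: "u = xs @ [j, j] @ ys"
  then have "1 \<le> j"
    using exchange_set[OF assms(2)] rsf_word_bounds[OF assms(1), of j] by auto
  then obtain i where "j = Suc i" by (cases j) auto
  with proj_rsf_word_no_repeat[OF assms(1), of i] u show False
    by (simp add: exchange_proj[OF assms(2), symmetric] successively_append_iff)
qed

text \<open>On the bonds \<open>j - 1\<close>, \<open>j\<close> the middle gate is invisible, and
  the pattern shows \<open>j\<close> twice in a row.\<close>

lemma rsf_no_braid:
  assumes "spaced 1 L ks" "exchange id u (rsf_word ks)"
  shows "u \<noteq> xs @ [j, Suc j, j] @ ys"
proof
  assume u: "u = xs @ [j, Suc j, j] @ ys"
  then have "1 \<le> j"
    using exchange_set[OF assms(2)] rsf_word_bounds[OF assms(1), of j] by auto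
  then obtain i where "j = Suc i" by (cases j) auto
  with proj_rsf_word_no_repeat[OF assms(1), of i] u show False
    by (simp add: exchange_proj[OF assms(2), symmetric] successively_append_iff)
qed

text \<open>Restricted to the bonds \<open>j - 1\<close>, \<open>j\<close> the word would end in
  \<open>j\<close>, restricted to \<open>j\<close>, \<open>Suc j\<close> it would end in
  \<open>Suc j\<close>, contrary to \<open>proj_rsf_word_last\<close>.\<close>

lemma rsf_no_vacuum_pair:
  assumes "spaced 1 L ks" "exchange id u (rsf_word ks)"
    and vac: "\<forall>b\<in>set ys. {b, b + 1} \<inter> {j, j + 1, j + 2} = {}"
  shows "u \<noteq> xs @ [j, Suc j] @ ys"
proof
  assume u: "u = xs @ [j, Suc j] @ ys"
  then have "1 \<le> j"
    using exchange_set[OF assms(2)] rsf_word_bounds[OF assms(1), of j] by auto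
  then obtain i where j: "j = Suc i" by (cases j) auto
  have "proj i ys = []" "proj (Suc i) ys = []" using vac j by (auto intro!: proj_eq_Nil)
  then have "proj i u = proj i xs @ [Suc i]" "proj (Suc i) u = proj (Suc i) xs @ [Suc i, Suc (Suc i)]"
    using u j by auto
  with proj_rsf_word_last[OF assms(1), of i] show False
    by (simp add: exchange_proj[OF assms(2), symmetric])
qed

section \<open>Attainable layouts and excluded steps\<close>

definition reaches :: "step \<Rightarrow> marked_gate list \<Rightarrow> layout \<Rightarrow> bool" where
  "reaches s w ks \<longleftrightarrow> (\<exists>v. run s w v \<and> exchange id (map bond v) (rsf_word ks))"

lemma reaches_cong: "same_circuit w w' \<Longrightarrow> reaches s w' ks \<Longrightarrow> reaches s w ks"
  unfolding reaches_def by (meson exchange_bonds exchange_sym exchange_trans run_cong)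

lemma rsf_no_multiply:
  assumes "spaced 1 L ks" "exchange id (map bond w) (rsf_word ks)"
  shows "\<not> multiply w u"
proof
  assume "multiply w u"
  then obtain xs q ys w' where "same_circuit w w'" "map bond w' = map bond xs @ [q, q] @ map bond ys"
    unfolding multiply_def by force
  with rsf_no_pair[OF assms(1)] show False
    by (meson assms(2) exchange_bonds exchange_sym exchange_trans)
qed

lemma rsf_no_rewrite:
  assumes "spaced 1 L ks" "exchange id (map bond w) (rsf_word ks)"
  shows "\<not> rewrite s w u"
proof
  assume *: "rewrite s w u"
  have ex: "exchange id (map bond w') (rsf_word ks)" if "same_circuit w w'" for w'
    using that assms(2) by (meson exchange_bonds exchange_sym exchange_trans)
  show False
  proof (cases s)
    case Step1
    with * obtain xs j ys where "same_circuit w (xs @ [New j, Old (j + 1), Old j] @ ys)" by auto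
    from rsf_no_braid[OF assms(1) ex[OF this], of "map bond xs" j "map bond ys"] show False by simp
  next
    case Step2
    with * obtain xs j ys where "same_circuit w (xs @ [New j, Old (j + 1)] @ ys)"
      "vacuum_on {j, j + 1, j + 2} ys" by auto
    with rsf_no_vacuum_pair[OF assms(1) ex[OF this(1)], of "map bond ys" j "map bond xs"]
    show False by (simp add: vacuum_on_def)
  next
    case Step3
    with * obtain xs j ys where "same_circuit w (xs @ [Old j, New (j + 1)] @ ys)"
      "vacuum_on {j, j + 1, j + 2} ys" by auto
    with rsf_no_vacuum_pair[OF assms(1) ex[OF this(1)], of "map bond ys" j "map bond xs"]
    show False by (simp add: vacuum_on_def)
  next
    case Step4
    with * obtain xs j ys where "same_circuit w (xs @ [Old j, Old (j + 1), New j] @ ys)" by auto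
    from rsf_no_braid[OF assms(1) ex[OF this], of "map bond xs" j "map bond ys"] show False by simp
  qed
qed

text \<open>An RSF word admits neither a merge nor a rewrite, so from any step the algorithm falls
  through to its end. Absorptions that add a gate end this way.\<close>

lemma reaches_rsf:
  assumes "spaced 1 L ks" "exchange id (map bond w) (rsf_word ks)"
  shows "reaches s w ks"
proof -
  note no = rsf_no_multiply[OF assms] rsf_no_rewrite[OF assms]
  have 4: "run Step4 w w" using no by (intro run.terminated) auto
  have 3: "run Step3 w w" using no 4 by (intro run.continued[of w Step3 Step4]) auto
  have 2: "run Step2 w w" using no 3 by (intro run.continued[of w Step2 Step3]) auto
  have 1: "run Step1 w w" using no 2 by (intro run.continued[of w Step1 Step2]) auto
  show ?thesis using 1 2 3 4 assms(2) unfolding reaches_def by (cases s) auto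
qed

lemma reaches_multiplied:
  assumes "same_circuit w (xs @ [New q, Old q] @ ys) \<or> same_circuit w (xs @ [Old q, New q] @ ys)"
    and "exchange id (map bond xs @ q # map bond ys) (rsf_word ks)"
  shows "reaches s w ks"
  using assms run.multiplied[of w "xs @ [Old q] @ ys" s]
  unfolding reaches_def multiply_def by fastforce

lemma reaches_rewritten:
  assumes "\<nexists>u. multiply w u" "rewrite s w w'" "reaches (step_after_rewrite s) w' ks"
  shows "reaches s w ks"
  using assms run.rewritten unfolding reaches_def by blast

lemma reaches_continued:
  assumes "\<nexists>u. multiply w u" "\<nexists>u. rewrite s w u" "step_after_failure s = Some s'" "reaches s' w ks"
  shows "reaches s w ks"
  using assms run.continued unfolding reaches_def by blast

text \<open>In product order: \<open>us\<close> acts after the new gate, \<open>vs\<close> before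
  it.\<close>

definition marked :: "nat list \<Rightarrow> nat \<Rightarrow> nat list \<Rightarrow> marked_gate list" where
  "marked us q vs = map Old us @ New q # map Old vs"

lemma bonds_marked [simp]: "map bond (marked us q vs) = us @ q # vs"
  by (simp add: marked_def comp_def)

text \<open>The new gate is the only one of its kind and lies on a bond kept by the filter, so the
  equality of the filtered words can be cut at it.\<close>

lemma marked_splitD:
  assumes "same_circuit (marked us q vs) (xs @ New q' # zs)"
  shows "q' = q"
    and "i = q \<or> Suc i = q \<Longrightarrow> proj i (map bond xs) = proj i us \<and> proj i (map bond zs) = proj i vs"
proof -
  have "New q' \<in> set (marked us q vs)" using exchange_set[OF assms] by simp
  then show q: "q' = q" by (auto simp: marked_def)
  let ?f = "filter (\<lambda>g. bond g = i \<or> bond g = Suc i)"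
  assume i: "i = q \<or> Suc i = q"
  have bond: "map bond (?f w) = proj i (map bond w)" for w
    by (simp add: proj_def filter_map comp_def)
  have "?f (map Old us) @ New q # ?f (map Old vs) = ?f xs @ New q # ?f zs"
    using exchange_filter[OF assms, of i] i q by (auto simp: marked_def)
  then have "?f (map Old us) = ?f xs \<and> ?f (map Old vs) = ?f zs"
    by (subst (asm) append_Cons_eq_iff) auto
  then have "map bond (?f (map Old us)) = map bond (?f xs)" "map bond (?f (map Old vs)) = map bond (?f zs)"
    by simp_all
  then show "proj i (map bond xs) = proj i us \<and> proj i (map bond zs) = proj i vs"
    by (simp add: bond comp_def)
qed

text \<open>A merge needs an old gate on \<open>q\<close> with no gate on \<open>q - 1\<close> or
  \<open>q + 1\<close> in between. On each side the assumption names an obstruction: no gate on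
  \<open>q\<close> at all, or a gate on a neighbouring bond that is nearer.\<close>

lemma no_multiply:
  assumes q: "1 \<le> q"
    and left: "q \<notin> set us \<or> last (proj q us) = Suc q \<or> last (proj (q - 1) us) = q - 1"
    and right: "q \<notin> set vs \<or> hd (proj q vs) = Suc q \<or> hd (proj (q - 1) vs) = q - 1"
  shows "\<nexists>u. multiply (marked us q vs) u"
proof (intro notI, elim exE)
  fix u assume "multiply (marked us q vs) u"
  then consider xs q' ys where "same_circuit (marked us q vs) (xs @ New q' # Old q' # ys)"
    | xs q' ys where "same_circuit (marked us q vs) ((xs @ [Old q']) @ New q' # ys)"
    unfolding multiply_def by auto
  then show False
  proof cases
    case 1
    note split = marked_splitD[OF 1]
    have a: "proj q vs = q # proj q (map bond ys)" "proj (q - 1) vs = q # proj (q - 1) (map bond ys)"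
      using split(1) split(2)[of q] split(2)[of "q - 1"] q by auto
    then have "q \<in> set (proj q vs)" by simp
    then have "q \<in> set vs" by (simp add: set_proj)
    then show False using right a q by auto
  next
    case 2
    note split = marked_splitD[OF 2]
    have a: "proj q us = proj q (map bond xs) @ [q]" "proj (q - 1) us = proj (q - 1) (map bond xs) @ [q]"
      using split(1) split(2)[of q] split(2)[of "q - 1"] q by auto
    then have "q \<in> set (proj q us)" by simp
    then have "q \<in> set us" by (simp add: set_proj)
    then show False using left a q by auto
  qed
qed

lemma no_Step1:
  assumes "q \<notin> set vs"
  shows "\<nexists>u. rewrite Step1 (marked us q vs) u"
proof (intro notI, elim exE)
  fix u assume "rewrite Step1 (marked us q vs) u"
  then obtain xs j ys where "same_circuit (marked us q vs) (xs @ New j # Old (j + 1) # Old j # ys)" by auto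
  note split = marked_splitD[OF this]
  have "q \<in> set (proj q (map bond (Old (j + 1) # Old j # ys)))" using split(1) by simp
  also have "proj q (map bond (Old (j + 1) # Old j # ys)) = proj q vs" using split(2)[of q] by blast
  finally have "q \<in> set (proj q vs)" .
  then show False using assms by (simp add: set_proj)
qed

lemma no_Step2:
  assumes "Suc q \<notin> set vs"
  shows "\<nexists>u. rewrite Step2 (marked us q vs) u"
proof (intro notI, elim exE)
  fix u assume "rewrite Step2 (marked us q vs) u"
  then obtain xs j ys where "same_circuit (marked us q vs) (xs @ New j # Old (j + 1) # ys)" by auto
  note split = marked_splitD[OF this]
  have "Suc q \<in> set (proj q (map bond (Old (j + 1) # ys)))" using split(1) by simp
  also have "proj q (map bond (Old (j + 1) # ys)) = proj q vs" using split(2)[of q] by blast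
  finally have "Suc q \<in> set (proj q vs)" .
  then show False using assms by (simp add: set_proj)
qed

section \<open>Termination of the absorption algorithm\<close>

lemma same_circuit_moveR:
  assumes "\<forall>b\<in>set zs. b + 2 \<le> q \<or> q + 2 \<le> b"
  shows "same_circuit (xs @ New q # map Old zs @ ys) (xs @ map Old zs @ New q # ys)"
  using exchange_context[OF exchange_move[of "map Old zs" bond "New q"], of xs ys] assms by auto

lemma same_circuit_moveR_Old:
  assumes "\<forall>b\<in>set zs. b + 2 \<le> q \<or> q + 2 \<le> b"
  shows "same_circuit (xs @ Old q # map Old zs @ ys) (xs @ map Old zs @ Old q # ys)"
  using exchange_context[OF exchange_move[of "map Old zs" bond "Old q"], of xs ys] assms by auto

lemma rev_upt_Suc: "a \<le> b \<Longrightarrow> rev [a..<Suc b] = b # rev [a..<b]"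
  by simp

lemma rev_upt_snoc: "a < b \<Longrightarrow> rev [a..<b] = rev [Suc a..<b] @ [a]"
  by (simp add: upt_conv_Cons)

lemma rev_upt_split: "a \<le> c \<Longrightarrow> c \<le> b \<Longrightarrow> rev [a..<b] = rev [c..<b] @ rev [a..<c]"
  by (metis le_add_diff_inverse rev_append upt_add_eq_append)

lemma left_tail:
  assumes "spaced 1 L ks" "next_start 1 ks \<le> q + 1" "1 \<le> q"
  shows "q \<notin> set (rsf_word ks) \<or> last (proj (q - 1) (rsf_word ks)) = q - 1"
proof -
  from proj_rsf_word_tail[OF assms(1), of "q - 1"] assms(2,3)
  consider "proj (q - 1) (rsf_word ks) = []" | "last (proj (q - 1) (rsf_word ks)) = q - 1" by auto
  then show ?thesis
  proof cases
    case 1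
    then have "q \<notin> set (proj (q - 1) (rsf_word ks))" by simp
    then show ?thesis using assms(3) by (simp add: set_proj)
  qed simp
qed

lemma vacuum_on_map_Old:
  "vacuum_on Q (map Old vs) \<longleftrightarrow> (\<forall>b\<in>set vs. b \<notin> Q \<and> Suc b \<notin> Q)"
  by (auto simp: vacuum_on_def)

text \<open>No remaining chain meets the qubits of the new gate. Either a chain may start at
  \<open>q\<close>, or the preceding chain ends in \<open>q\<close>, \<open>q - 1\<close>; then Step
  3 takes the new gate past \<open>q - 1\<close> and it merges with the gate on
  \<open>q\<close>.\<close>

lemma reaches_bottom:
  assumes pre: "spaced 1 L ks" and post: "spaced (q + 2) L ks'" and q: "1 \<le> q" "q < L"
    and tail: "next_start 1 ks \<le> q \<or> (\<exists>ks0 l. ks = ks0 @ [(q - 1, l)] \<and> 2 \<le> l)"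
  shows "\<exists>r. spaced 1 L r \<and> reaches Step1 (marked (rsf_word ks) q (rsf_word ks')) r
    \<and> (r = ks @ ks' \<or> length (rsf_word r) = length (rsf_word (ks @ ks')) + 1)"
proof (cases "next_start 1 ks \<le> q")
  case True
  let ?r = "ks @ [(q, 1)] @ ks'"
  have "spaced 1 L ?r" using pre post q True by (auto simp: spaced_append)
  moreover from this have "reaches Step1 (marked (rsf_word ks) q (rsf_word ks')) ?r"
    by (rule reaches_rsf) simp
  ultimately show ?thesis by (intro exI[of _ ?r]) auto
next
  case False
  then obtain ks0 l where ks: "ks = ks0 @ [(q - 1, l)]" and l: "2 \<le> l" using tail by blast
  define us where "us = rsf_word ks0 @ rev [q + 1..<q - 1 + l]"
  have "rev [q - 1..<q - 1 + l] = rev [q + 1..<q - 1 + l] @ [q, q - 1]"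
    using l q rev_upt_snoc[of "q - 1" "q - 1 + l"] rev_upt_snoc[of q "q - 1 + l"] by simp
  then have word: "rsf_word ks = us @ [q, q - 1]" by (simp add: ks us_def)
  let ?vs = "rsf_word ks'"
  have vs: "\<forall>b\<in>set ?vs. q + 2 \<le> b" using rsf_word_bounds[OF post] by blast
  let ?w = "marked (rsf_word ks) q ?vs" and ?w' = "map Old (us @ [q]) @ [New q, Old (q - 1)] @ map Old ?vs"
  have nm: "\<nexists>u. multiply ?w u"
    using q vs by (intro no_multiply) (auto simp: word)
  have sp: "spaced 1 L (ks @ ks')" using pre post q ks by (auto simp: spaced_append intro: spaced_mono)
  have "reaches Step4 ?w' (ks @ ks')"
    by (rule reaches_multiplied[where xs = "map Old us" and q = q and ys = "Old (q - 1) # map Old ?vs"])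
      (auto simp: word comp_def)
  moreover have "rewrite Step3 ?w ?w'"
    unfolding rewrite.simps vacuum_on_map_Old
  proof (intro exI conjI)
    let ?j = "q - 1"
    show "same_circuit ?w (map Old (us @ [q]) @ [Old ?j, New (?j + 1)] @ map Old ?vs)"
      using q by (simp add: marked_def word)
    show "vacuum_on {?j, ?j + 1, ?j + 2} (map Old ?vs)"
      using vs q by (auto simp: vacuum_on_map_Old)
    show "?w' = map Old (us @ [q]) @ [New (?j + 1), Old ?j] @ map Old ?vs" using q by simp
  qed
  ultimately have "reaches Step3 ?w (ks @ ks')"
    using reaches_rewritten[OF nm] by (metis step_after_rewrite.simps(3))
  then have "reaches Step2 ?w (ks @ ks')"
    using vs by (intro reaches_continued[OF nm no_Step2]) auto
  then have "reaches Step1 ?w (ks @ ks')"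
    using vs by (intro reaches_continued[OF nm no_Step1]) auto
  with sp show ?thesis by blast
qed

text \<open>
  The gates that \<open>n\<close> rounds of Step 4 leave below the climbing gate, which is then at bond \<open>q + n\<close>.
\<close>

fun zigzag :: "nat \<Rightarrow> nat \<Rightarrow> nat list" where
  "zigzag q 0 = [q - 1]"
| "zigzag q (Suc n) = (q + n) # (q + n + 1) # zigzag q n"

lemma zigzag_first:
  "1 \<le> q \<Longrightarrow> hd (proj (q + n - 1) (zigzag q n)) = q + n - 1"
  by (cases n) auto

text \<open>The gate on \<open>q + n + 1\<close> commutes with the chain on the bonds
  \<open>q - 1\<close> to \<open>q + n - 1\<close>, so the pairs sort into two descending
  chains.\<close>

lemma zigzag_unzip:
  assumes "1 \<le> q"
  shows "exchange id (zigzag q n) (rev [q - 1..<q + n] @ rev [q + 1..<q + n + 1])"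
proof (induction n)
  case 0
  show ?case using assms rev_upt_snoc[of "q - 1" q] by simp
next
  case (Suc n)
  let ?a = "rev [q - 1..<q + n]" and ?b = "rev [q + 1..<q + n + 1]"
  have "exchange id (zigzag q (Suc n)) ([q + n, q + n + 1] @ ?a @ ?b)"
    using exchange_context[OF Suc, of "[q + n, q + n + 1]" "[]"]
    by (simp only: zigzag.simps append_Cons append_Nil append_Nil2)
  also have "exchange id ([q + n, q + n + 1] @ ?a @ ?b) ([q + n] @ ?a @ [q + n + 1] @ ?b)"
    using exchange_context[OF exchange_move[of ?a id "q + n + 1"], of "[q + n]" ?b] by fastforce
  finally have "exchange id (zigzag q (Suc n)) (([q + n] @ ?a) @ [q + n + 1] @ ?b)"
    by (simp only: append_assoc)
  moreover have "rev [q - 1..<q + Suc n] = [q + n] @ ?a" "rev [q + 1..<q + Suc n + 1] = [q + n + 1] @ ?b"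
    using assms by simp_all
  ultimately show ?case by (simp only:)
qed

text \<open>Each round of Step 4 uses the lowest remaining gate of both chains. If the first chain
  is used up, the two chains have exchanged their upper parts and there is one gate more; if only
  the second is, the new gate merges into the first.\<close>

lemma reaches_climb:
  assumes q: "1 \<le> q" and l: "2 \<le> l" and pre: "spaced 1 L (ks @ [(q - 1, l), (q + 1, l')] @ ks')"
    and c: "c = q + n" "c \<le> q - 1 + l" "c \<le> q + l'"
  shows "\<exists>r. spaced 1 L r
    \<and> reaches Step4 (marked (rsf_word ks @ rev [c..<q - 1 + l] @ rev [c + 1..<q + 1 + l']) c
        (zigzag q n @ rsf_word ks')) r
    \<and> (r = ks @ [(q - 1, l), (q + 1, l')] @ ks' \<or>
       length (rsf_word r) = length (rsf_word (ks @ [(q - 1, l), (q + 1, l')] @ ks')) + 1)"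
  using c
proof (induction "q - 1 + l - c" arbitrary: c n)
  case 0
  then have c: "c = q - 1 + l" by simp
  \<comment> \<open>The new gate on \<open>c\<close> links the rest of the second chain to the run
    down to \<open>q - 1\<close>; what is left over is a chain of \<open>n = l - 1\<close> gates
    from \<open>q + 1\<close>.\<close>
  let ?r = "ks @ [(q - 1, l' + 2), (q + 1, n)] @ ks'"
  have "spaced 1 L ?r" using pre q 0 c l by (auto simp: spaced_append)
  moreover have "exchange id (rsf_word ks @ rev [c + 1..<q + 1 + l'] @ c # zigzag q n @ rsf_word ks') (rsf_word ?r)"
  proof -
    have "exchange id (zigzag q n) (rev [q - 1..<c] @ rev [q + 1..<q + 1 + n])"
      using zigzag_unzip[OF q, of n] unfolding 0(2) by (simp only: ac_simps)
    from exchange_context[OF this, of "rsf_word ks @ rev [c + 1..<q + 1 + l'] @ [c]" "rsf_word ks'"]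
    have "exchange id (rsf_word ks @ rev [c + 1..<q + 1 + l'] @ c # zigzag q n @ rsf_word ks')
      (rsf_word ks @ (rev [c + 1..<q + 1 + l'] @ [c] @ rev [q - 1..<c]) @ rev [q + 1..<q + 1 + n] @ rsf_word ks')"
      by simp
    also have "rev [c + 1..<q + 1 + l'] @ [c] @ rev [q - 1..<c] = rev [q - 1..<q - 1 + (l' + 2)]"
      using rev_upt_split[of "q - 1" c "q + 1 + l'"] rev_upt_snoc[of c "q + 1 + l'"] q 0 by simp
    finally show ?thesis by (simp only: rsf_word_simps append_assoc append_Cons append_Nil append_Nil2)
  qed
  ultimately have "reaches Step4 (marked (rsf_word ks @ rev [c..<q - 1 + l] @ rev [c + 1..<q + 1 + l']) c
        (zigzag q n @ rsf_word ks')) ?r"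
    using c by (intro reaches_rsf) auto
  with \<open>spaced 1 L ?r\<close> show ?case using c 0 l q by (intro exI[of _ ?r]) auto
next
  case (Suc d)
  then have c: "c < q - 1 + l" by simp
  define us where "us = rsf_word ks @ rev [c + 1..<q - 1 + l]"
  let ?vs = "zigzag q n @ rsf_word ks'"
  have hi: "\<forall>b\<in>set (rsf_word ks'). q + 3 \<le> b"
    using pre rsf_word_bounds[of "q + 1 + 2" L ks'] by (auto simp: spaced_append numeral_3_eq_3)
  show ?case
  proof (cases "c = q + l'")
    case True
    \<comment> \<open>The second chain is used up, so the gate on \<open>c\<close> in the first
      chain is adjacent to the new one and merging restores the layout.\<close>
    let ?r = "ks @ [(q - 1, l), (q + 1, l')] @ ks'"
    have n: "n = l'" using True Suc by simp
    have "exchange id (zigzag q n) (rev [q - 1..<c] @ rev [q + 1..<q + 1 + l'])"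
      using zigzag_unzip[OF q, of n] unfolding n True by (simp only: ac_simps)
    from exchange_context[OF this, of "us @ [c]" "rsf_word ks'"]
    have "exchange id (us @ c # ?vs) (us @ ([c] @ rev [q - 1..<c]) @ rev [q + 1..<q + 1 + l'] @ rsf_word ks')"
      by simp
    also have "us @ ([c] @ rev [q - 1..<c]) @ rev [q + 1..<q + 1 + l'] @ rsf_word ks' = rsf_word ?r"
      unfolding us_def using rev_upt_split[of "q - 1" c "q - 1 + l"] rev_upt_snoc[of c "q - 1 + l"] c Suc
      by simp
    finally have "exchange id (us @ c # ?vs) (rsf_word ?r)" .
    then have "reaches Step4 (marked (us @ [c]) c ?vs) ?r"
      by (intro reaches_multiplied[where xs = "map Old us" and q = c and ys = "map Old ?vs"])
        (auto simp: marked_def comp_def)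
    moreover have "rsf_word ks @ rev [c..<q - 1 + l] @ rev [c + 1..<q + 1 + l'] = us @ [c]"
      using c True rev_upt_snoc[of c "q - 1 + l"] by (simp add: us_def)
    ultimately show ?thesis using pre by (intro exI[of _ ?r]) simp
  next
    case False
    then have c': "c < q + l'" using Suc by simp
    \<comment> \<open>The gate on \<open>c\<close> commutes past these bonds and meets the gate on
      \<open>c + 1\<close>, which gives the pattern of Step 4.\<close>
    let ?zs = "rev [c + 2..<q + 1 + l']"
    have left: "rsf_word ks @ rev [c..<q - 1 + l] @ rev [c + 1..<q + 1 + l'] = us @ [c] @ ?zs @ [c + 1]"
      using c c' rev_upt_snoc[of c "q - 1 + l"] rev_upt_snoc[of "c + 1" "q + 1 + l'"] by (simp add: us_def)
    let ?w = "marked (us @ [c] @ ?zs @ [c + 1]) c ?vs"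
    let ?w' = "marked (us @ ?zs) (c + 1) (c # (c + 1) # ?vs)"
    \<comment> \<open>The gate on \<open>c - 1\<close> left by Step 3 or by the previous round
      shields the new gate from merging with earlier ones.\<close>
    have "proj (c - 1) ?vs \<noteq> [] \<and> hd (proj (c - 1) ?vs) = c - 1"
      using zigzag_first[OF q, of n] Suc.prems q
      by (cases n) auto
    then have nm: "\<nexists>u. multiply ?w u"
      using Suc.prems q by (intro no_multiply) auto
    have "rewrite Step4 ?w ?w'"
      unfolding rewrite.simps
    proof (intro exI conjI)
      have "\<forall>b\<in>set ?zs. b + 2 \<le> c \<or> c + 2 \<le> b" by auto
      from same_circuit_moveR_Old[OF this, of "map Old us" "Old (c + 1) # New c # map Old ?vs"]
      show "same_circuit ?w (map Old (us @ ?zs) @ [Old c, Old (c + 1), New c] @ map Old ?vs)"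
        by (simp only: marked_def map_append list.map append_assoc append_Cons append_Nil)
      show "?w' = map Old (us @ ?zs) @ [New (c + 1), Old c, Old (c + 1)] @ map Old ?vs"
        by (simp add: marked_def)
    qed
    note step = reaches_rewritten[OF nm this]
    have "\<exists>r. spaced 1 L r
      \<and> reaches Step4 (marked (rsf_word ks @ rev [c + 1..<q - 1 + l] @ rev [c + 1 + 1..<q + 1 + l']) (c + 1)
          (zigzag q (Suc n) @ rsf_word ks')) r
      \<and> (r = ks @ [(q - 1, l), (q + 1, l')] @ ks' \<or>
         length (rsf_word r) = length (rsf_word (ks @ [(q - 1, l), (q + 1, l')] @ ks')) + 1)"
      using Suc.hyps(2) Suc.prems c c' by (intro Suc.hyps(1)) auto
    moreover have "marked (rsf_word ks @ rev [c + 1..<q - 1 + l] @ rev [c + 1 + 1..<q + 1 + l']) (c + 1)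
        (zigzag q (Suc n) @ rsf_word ks') = ?w'"
      using Suc.prems by (simp add: us_def)
    ultimately show ?thesis using step unfolding left by auto
  qed
qed

text \<open>Step 2 takes the new gate past the lowest gate of the chain above it. If a chain may
  start at \<open>q\<close>, that chain is now extended downwards. Otherwise the previous chain
  starts at \<open>q - 1\<close>, Step 3 takes the new gate past its lowest gate, and the climb
  begins with \<open>n = 0\<close>.\<close>

lemma reaches_below:
  assumes sp: "spaced 1 L (ks @ (q + 1, l) # ks')" and q: "1 \<le> q"
    and tail: "next_start 1 ks \<le> q \<or> (\<exists>ks0 l. ks = ks0 @ [(q - 1, l)] \<and> 2 \<le> l)"
  shows "\<exists>r. spaced 1 L r \<and> reaches Step1 (marked (rsf_word ks) q (rsf_word ((q + 1, l) # ks'))) r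
    \<and> (r = ks @ (q + 1, l) # ks' \<or> length (rsf_word r) = length (rsf_word (ks @ (q + 1, l) # ks')) + 1)"
proof -
  let ?zs = "rev [q + 2..<q + 1 + l]" and ?vs = "rsf_word ks'"
  have sp': "spaced 1 L ks" "next_start 1 ks \<le> q + 1" "1 \<le> l" "q + 1 + l \<le> L" "spaced (q + 3) L ks'"
    using sp by (auto simp: spaced_append numeral_3_eq_3)
  have hi: "\<forall>b\<in>set ?vs. q + 3 \<le> b" using rsf_word_bounds[OF sp'(5)] by blast
  have word: "rsf_word ((q + 1, l) # ks') = ?zs @ [q + 1] @ ?vs"
    using rev_upt_snoc[of "q + 1" "q + 1 + l"] sp'(3) by simp
  let ?w = "marked (rsf_word ks) q (?zs @ [q + 1] @ ?vs)" and ?w' = "marked (rsf_word ks @ ?zs @ [q + 1]) q ?vs"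
  have nm: "\<nexists>u. multiply ?w u"
    using q left_tail[OF sp'(1,2) q] hi by (intro no_multiply) auto
  have nm': "\<nexists>u. multiply ?w' u"
    using q hi by (intro no_multiply) auto
  have rw: "rewrite Step2 ?w ?w'"
    unfolding rewrite.simps vacuum_on_map_Old
  proof (intro exI conjI)
    have "\<forall>b\<in>set ?zs. b + 2 \<le> q \<or> q + 2 \<le> b" by auto
    from same_circuit_moveR[OF this, of "map Old (rsf_word ks)" "Old (q + 1) # map Old ?vs"]
    show "same_circuit ?w (map Old (rsf_word ks @ ?zs) @ [New q, Old (q + 1)] @ map Old ?vs)"
      by (simp only: marked_def map_append list.map append_assoc append_Cons append_Nil)
    show "vacuum_on {q, q + 1, q + 2} (map Old ?vs)"
      using hi by (auto simp: vacuum_on_map_Old)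
    show "?w' = map Old (rsf_word ks @ ?zs) @ [Old (q + 1), New q] @ map Old ?vs"
      by (simp add: marked_def)
  qed
  have from3: "reaches Step1 ?w r" if "reaches Step3 ?w' r" for r
  proof -
    have "reaches Step2 ?w r" using reaches_rewritten[OF nm rw] that by simp
    then show ?thesis using hi by (intro reaches_continued[OF nm no_Step1]) auto
  qed
  show ?thesis
  proof (cases "next_start 1 ks \<le> q")
    case True
    let ?r = "ks @ (q, l + 1) # ks'"
    have "rev [q..<q + (l + 1)] = ?zs @ [q + 1, q]"
      using rev_upt_snoc[of q "q + (l + 1)"] rev_upt_snoc[of "q + 1" "q + 1 + l"] sp'(3) by simp
    then have "rsf_word ?r = map bond ?w'"
      by (simp only: rsf_word_simps bonds_marked append_assoc append_Cons append_Nil)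
    then have ex: "exchange id (map bond ?w') (rsf_word ?r)" by (simp only: exchange_refl)
    have r: "spaced 1 L ?r"
      using sp' True spaced_mono[OF sp'(5), of "q + 2"] by (simp add: spaced_append)
    have "reaches Step1 ?w ?r" by (rule from3, rule reaches_rsf[OF r ex])
    with r show ?thesis unfolding word by (intro exI[of _ ?r]) (simp add: word)
  next
    case False
    then obtain ks0 l0 where ks: "ks = ks0 @ [(q - 1, l0)]" and l0: "2 \<le> l0" using tail by blast
    define us where "us = rsf_word ks0 @ rev [q + 1..<q - 1 + l0]"
    have "rev [q - 1..<q - 1 + l0] = rev [q + 1..<q - 1 + l0] @ [q, q - 1]"
      using l0 q rev_upt_snoc[of "q - 1" "q - 1 + l0"] rev_upt_snoc[of q "q - 1 + l0"] by simp
    then have us: "rsf_word ks = us @ [q, q - 1]" by (simp add: ks us_def)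
    let ?w'' = "marked (us @ [q] @ ?zs @ [q + 1]) q ((q - 1) # ?vs)"
    have "rewrite Step3 ?w' ?w''"
      unfolding rewrite.simps vacuum_on_map_Old
    proof (intro exI conjI)
      let ?j = "q - 1"
      have "\<forall>b\<in>set (?zs @ [q + 1]). b + 2 \<le> ?j \<or> ?j + 2 \<le> b" using q by auto
      from same_circuit_moveR_Old[OF this, of "map Old (us @ [q])" "New q # map Old ?vs"]
      show "same_circuit ?w' (map Old (us @ [q] @ ?zs @ [q + 1]) @ [Old ?j, New (?j + 1)] @ map Old ?vs)"
        using q by (simp only: marked_def us map_append list.map append_assoc append_Cons append_Nil le_add_diff_inverse2)
      show "vacuum_on {?j, ?j + 1, ?j + 2} (map Old ?vs)"
        using hi q by (auto simp: vacuum_on_map_Old)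
      show "?w'' = map Old (us @ [q] @ ?zs @ [q + 1]) @ [New (?j + 1), Old ?j] @ map Old ?vs"
        using q by (simp add: marked_def)
    qed
    note step = reaches_rewritten[OF nm' this]
    have "us @ [q] @ ?zs @ [q + 1] = rsf_word ks0 @ rev [q..<q - 1 + l0] @ rev [q + 1..<q + 1 + l]"
      using rev_upt_snoc[of q "q - 1 + l0"] rev_upt_snoc[of "q + 1" "q + 1 + l"] l0 sp'(3) q
      by (simp add: us_def)
    then have w'': "?w'' = marked (rsf_word ks0 @ rev [q..<q - 1 + l0] @ rev [q + 1..<q + 1 + l]) q
        (zigzag q 0 @ rsf_word ks')" by simp
    have "\<exists>r. spaced 1 L r
      \<and> reaches Step4 (marked (rsf_word ks0 @ rev [q..<q - 1 + l0] @ rev [q + 1..<q + 1 + l]) q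
          (zigzag q 0 @ rsf_word ks')) r
      \<and> (r = ks0 @ [(q - 1, l0), (q + 1, l)] @ ks' \<or>
         length (rsf_word r) = length (rsf_word (ks0 @ [(q - 1, l0), (q + 1, l)] @ ks')) + 1)"
      by (rule reaches_climb) (use sp l0 q ks in auto)
    then show ?thesis
      using from3 step unfolding w'' word ks by auto
  qed
qed

text \<open>
  The last assumption is an invariant of Step 1: the new gate gets to bond \<open>q\<close> past a chain starting
  at \<open>q - 1\<close> only by having been shifted by it, which takes a chain of at least two gates.
\<close>

theorem reaches_total:
  assumes "spaced 1 L (ks @ ks')" "1 \<le> q" "q < L"
    and "next_start 1 ks \<le> q \<or> (\<exists>ks0 l. ks = ks0 @ [(q - 1, l)] \<and> 2 \<le> l)"
  shows "\<exists>r. spaced 1 L r \<and> reaches Step1 (marked (rsf_word ks) q (rsf_word ks')) r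
    \<and> (r = ks @ ks' \<or> length (rsf_word r) = length (rsf_word (ks @ ks')) + 1)"
  using assms
proof (induction ks' arbitrary: ks q)
  case Nil
  then show ?case using reaches_bottom[of L ks q "[]"] by simp
next
  case (Cons x R)
  obtain k l where x: "x = (k, l)" by force
  let ?us = "rsf_word ks" and ?vs = "rsf_word R"
  have sp: "spaced 1 L ks" "next_start 1 ks \<le> k" "1 \<le> l" "k + l \<le> L" "spaced (k + 2) L R"
    using Cons.prems(1) by (auto simp: x spaced_append)
  have tail: "next_start 1 ks \<le> q + 1" using Cons.prems(2,4) by auto
  consider "q + 2 \<le> k" | "k = q + 1" | "k \<le> q" "q + 1 < k + l" | "q + 1 = k + l" | "q = k + l" | "k + l + 1 \<le> q"
    by linarith
  then show ?case
  proof cases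
    case 1
    then show ?thesis
      using sp Cons.prems by (intro reaches_bottom) (auto simp: x spaced_append)
  next
    case 2
    then show ?thesis
      using reaches_below[of L ks q l R] Cons.prems by (simp add: x)
  next
    case 3
    let ?hi = "rev [q + 2..<k + l]" and ?lo = "rev [k..<q]"
    let ?w = "marked ?us q (rsf_word (x # R))" and ?w' = "map Old (?us @ ?hi @ [q + 1, q]) @ New (q + 1) # map Old ?lo @ map Old ?vs"
    have word: "rev [k..<k + l] = ?hi @ [q + 1, q] @ ?lo"
      using 3 rev_upt_split[of k q "k + l"] rev_upt_snoc[of q "k + l"] rev_upt_snoc[of "q + 1" "k + l"] by simp
    have nm: "\<nexists>u. multiply ?w u"
      using Cons.prems(2) left_tail[OF sp(1) tail] proj_eq_Nil[of q ?hi]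
      by (intro no_multiply) (auto simp: x word)
    have rw: "rewrite Step1 ?w ?w'"
      unfolding rewrite.simps
    proof (intro exI conjI)
      have "\<forall>b\<in>set ?hi. b + 2 \<le> q \<or> q + 2 \<le> b" by auto
      from same_circuit_moveR[OF this, of "map Old ?us" "Old (q + 1) # Old q # map Old (?lo @ ?vs)"]
      show "same_circuit ?w (map Old (?us @ ?hi) @ [New q, Old (q + 1), Old q] @ map Old (?lo @ ?vs))"
        by (simp only: marked_def x word rsf_word_simps map_append list.map append_assoc append_Cons append_Nil)
      show "?w' = map Old (?us @ ?hi) @ [Old (q + 1), Old q, New (q + 1)] @ map Old (?lo @ ?vs)" by simp
    qed
    have eq: "same_circuit ?w' (marked (rsf_word (ks @ [(k, l)])) (q + 1) ?vs)"
      using same_circuit_moveR[of ?lo "q + 1" "map Old (?us @ ?hi @ [q + 1, q])" "map Old ?vs"]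
      by (simp add: marked_def word)
    \<comment> \<open>The chain just passed starts at \<open>q\<close> or below. Only a start at
      \<open>q\<close> is too close to the shifted bond \<open>q + 1\<close>, and then
      \<open>q + 1 < k + l\<close> makes the chain long enough.\<close>
    have "next_start 1 (ks @ [(k, l)]) \<le> q + 1 \<or> (\<exists>ks0 l'. ks @ [(k, l)] = ks0 @ [(q + 1 - 1, l')] \<and> 2 \<le> l')"
      using 3 by (cases "k = q") auto
    from Cons.IH[OF _ _ _ this] Cons.prems(1) 3 sp(4) obtain r where
      r: "spaced 1 L r" "reaches Step1 (marked (rsf_word (ks @ [(k, l)])) (q + 1) ?vs) r"
        "r = ks @ x # R \<or> length (rsf_word r) = length (rsf_word (ks @ x # R)) + 1"
      by (auto simp: x)
    have "reaches Step1 ?w r"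
      using reaches_rewritten[OF nm rw] reaches_cong[OF eq r(2)] by simp
    with r(1,3) show ?thesis by (intro exI[of _ r] conjI)
  next
    case 4
    have "rev [k..<k + l] = rev [k..<Suc q]" using 4 by simp
    also have "\<dots> = q # rev [k..<q]" by (rule rev_upt_Suc) (use 4 sp(3) in simp)
    finally have "reaches Step1 (marked ?us q (rsf_word (x # R))) (ks @ x # R)"
      by (intro reaches_multiplied[where xs = "map Old ?us" and q = q and ys = "map Old (rev [k..<q] @ ?vs)"])
        (auto simp: marked_def x comp_def)
    with Cons.prems(1) show ?thesis by blast
  next
    case 5
    let ?r = "ks @ (k, l + 1) # R"
    have "spaced 1 L ?r" using sp 5 Cons.prems(3) by (auto simp: spaced_append)
    moreover from this have "reaches Step1 (marked ?us q (rsf_word (x # R))) ?r"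
      by (rule reaches_rsf) (simp add: x 5)
    ultimately show ?thesis by (intro exI[of _ ?r]) (auto simp: x)
  next
    case 6
    have eq: "same_circuit (marked ?us q (rsf_word (x # R))) (marked (rsf_word (ks @ [(k, l)])) q ?vs)"
      using same_circuit_moveR[of "rev [k..<k + l]" q "map Old ?us" "map Old ?vs"] 6
      by (fastforce simp: marked_def x)
    from Cons.IH[of "ks @ [(k, l)]" q] Cons.prems 6 sp(3) obtain r where
      r: "spaced 1 L r" "reaches Step1 (marked (rsf_word (ks @ [(k, l)])) q ?vs) r"
        "r = ks @ x # R \<or> length (rsf_word r) = length (rsf_word (ks @ x # R)) + 1"
      by (auto simp: x)
    have "reaches Step1 (marked ?us q (rsf_word (x # R))) r" using reaches_cong[OF eq r(2)] .
    with r(1,3) show ?thesis by (intro exI[of _ r] conjI)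
  qed
qed

section \<open>Layouts as involutions\<close>

abbreviation layout_perm :: "layout \<Rightarrow> nat \<Rightarrow> nat" where
  "layout_perm ks \<equiv> word_perm (rsf_word ks)"

lemma partner_moves_end:
  assumes v: "v \<in> involutions_on {k..L}" "v k = k + j \<or> v k = k + j + 1" and j: "1 \<le> j" "k + j + 1 \<le> L"
  shows "partner (k + j) v \<in> involutions_on {k..L}"
    and "partner (k + j) v k = adj_swap (k + j) (v k)"
proof -
  show "partner (k + j) v \<in> involutions_on {k..L}"
    using v(1) j by (intro partner_in_involutions_on) auto
  have inv: "v (v x) = x" for x using v(1) by (simp add: involutions_on_def)
  have "v (k + j) = k \<or> v (Suc (k + j)) = k" using v(2) inv[of k] by auto
  then have "{v (k + j), v (Suc (k + j))} \<noteq> {k + j, Suc (k + j)}" using j by (auto simp: doubleton_eq_iff)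
  from partner_conjugate[OF this] show "partner (k + j) v k = adj_swap (k + j) (v k)"
    using j by (simp add: Transposition.transpose_def)
qed

text \<open>Position \<open>k + j\<close> holds \<open>k\<close>, the smallest value that occurs, so
  there is an ascent, and conjugation moves the far end of the arc by one.\<close>

lemma hecke_arc_step:
  assumes j: "1 \<le> j" "k + j + 1 \<le> L"
  shows "bij_betw (hecke (k + j)) {v \<in> involutions_on {k..L}. v k = k + j}
    {v \<in> involutions_on {k..L}. v k = k + Suc j}"
proof (rule bij_betw_byWitness[where f' = "partner (k + j)"])
  have hp: "hecke (k + j) v = partner (k + j) v" if v: "v \<in> involutions_on {k..L}" "v k = k + j" for v
  proof -
    have inv: "\<forall>x. v (v x) = x" using v(1) by (simp add: involutions_on_def)
    then have "v (k + j) = k" using v(2) by metis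
    moreover have "v (Suc (k + j)) \<in> {k..L}"
      by (subst permutes_in_image[of v]) (use v(1) j in \<open>auto simp: involutions_on_def\<close>)
    moreover have "v (Suc (k + j)) \<noteq> k" using inv v(2) by (metis n_not_Suc_n)
    ultimately show ?thesis using hecke_eq_partner[OF inv] by simp
  qed
  show "\<forall>v\<in>{v \<in> involutions_on {k..L}. v k = k + j}. partner (k + j) (hecke (k + j) v) = v"
    by (simp add: hp partner_partner)
  show "hecke (k + j) ` {v \<in> involutions_on {k..L}. v k = k + j} \<subseteq> {v \<in> involutions_on {k..L}. v k = k + Suc j}"
    using partner_moves_end[OF _ _ j] by (auto simp: hp)
  show sub: "partner (k + j) ` {v \<in> involutions_on {k..L}. v k = k + Suc j} \<subseteq> {v \<in> involutions_on {k..L}. v k = k + j}"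
    using partner_moves_end[OF _ _ j] by auto
  show "\<forall>v\<in>{v \<in> involutions_on {k..L}. v k = k + Suc j}. hecke (k + j) (partner (k + j) v) = v"
  proof
    fix v assume v: "v \<in> {v \<in> involutions_on {k..L}. v k = k + Suc j}"
    with sub have "partner (k + j) v \<in> {v \<in> involutions_on {k..L}. v k = k + j}" by blast
    then show "hecke (k + j) (partner (k + j) v) = v" by (simp add: hp partner_partner)
  qed
qed

lemma involutions_on_shrink:
  assumes "w \<in> involutions_on A" "\<forall>x\<in>A - B. w x = x" "B \<subseteq> A"
  shows "w \<in> involutions_on B"
  using assms by (auto simp: involutions_on_def permutes_def)

lemma involutions_on_mono: "w \<in> involutions_on B \<Longrightarrow> B \<subseteq> A \<Longrightarrow> w \<in> involutions_on A"
  by (auto simp: involutions_on_def intro: permutes_subset)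

lemma hecke_arc_start:
  assumes "k + 1 \<le> L"
  shows "bij_betw (hecke k) (involutions_on {k + 2..L}) {v \<in> involutions_on {k..L}. v k = k + 1}"
proof (rule bij_betw_byWitness[where f' = "partner k"])
  have fixed: "w k = k" "w (Suc k) = Suc k" if "w \<in> involutions_on {k + 2..L}" for w
    using that by (auto simp: involutions_on_def permutes_def)
  have hp: "hecke k w = partner k w" "partner k w = w \<circ> adj_swap k" if w: "w \<in> involutions_on {k + 2..L}" for w
    using fixed[OF w] w partner_commuting[of w k] hecke_eq_partner[of w k] by (auto simp: involutions_on_def)
  show "\<forall>w\<in>involutions_on {k + 2..L}. partner k (hecke k w) = w"
    by (simp add: hp(1) partner_partner)
  show "hecke k ` involutions_on {k + 2..L} \<subseteq> {v \<in> involutions_on {k..L}. v k = k + 1}"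
  proof safe
    fix w assume w: "w \<in> involutions_on {k + 2..L}"
    then have "w \<in> involutions_on {k..L}" by (rule involutions_on_mono) auto
    then show "hecke k w \<in> involutions_on {k..L}" using assms by (intro hecke_in_involutions_on) auto
    show "hecke k w k = k + 1" using hp[OF w] fixed[OF w] by simp
  qed
  show sub: "partner k ` {v \<in> involutions_on {k..L}. v k = k + 1} \<subseteq> involutions_on {k + 2..L}"
  proof safe
    fix v assume v: "v \<in> involutions_on {k..L}" "v k = k + 1"
    have "v (v x) = x" for x using v(1) by (simp add: involutions_on_def)
    with v(2) have vk: "v (Suc k) = k" by (metis Suc_eq_plus1)
    have "{v k, v (Suc k)} = {k, Suc k}" using v(2) vk by auto
    from partner_commuting[OF this] have "partner k v k = k" "partner k v (Suc k) = Suc k"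
      using v(2) vk by auto
    moreover have "partner k v \<in> involutions_on {k..L}"
      using v(1) assms by (intro partner_in_involutions_on) auto
    ultimately show "partner k v \<in> involutions_on {k + 2..L}"
      by (elim involutions_on_shrink) (auto simp: less_eq_Suc_le not_le le_less_Suc_eq elim!: le_SucE)
  qed
  show "\<forall>v\<in>{v \<in> involutions_on {k..L}. v k = k + 1}. hecke k (partner k v) = v"
  proof
    fix v assume "v \<in> {v \<in> involutions_on {k..L}. v k = k + 1}"
    with sub have "partner k v \<in> involutions_on {k + 2..L}" by blast
    then show "hecke k (partner k v) = v" by (simp add: hp(1) partner_partner)
  qed
qed

text \<open>The lowest gate joins the fixed points \<open>k\<close>, \<open>k + 1\<close>; the
  others carry the far end of this arc up to \<open>k + l\<close>. Each chain thus uses up two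
  points, which is the gap required between starts.\<close>

lemma hecke_arc:
  assumes "1 \<le> l" "k + l \<le> L"
  shows "bij_betw (foldr hecke (rev [k..<k + l])) (involutions_on {k + 2..L})
    {v \<in> involutions_on {k..L}. v k = k + l}"
  using assms
proof (induction l rule: nat_induct_at_least)
  case base
  then show ?case using hecke_arc_start[of k L] by simp
next
  case (Suc l)
  have eq: "foldr hecke (rev [k..<k + Suc l]) = hecke (k + l) \<circ> foldr hecke (rev [k..<k + l])" by simp
  have "bij_betw (foldr hecke (rev [k..<k + l])) (involutions_on {k + 2..L})
    {v \<in> involutions_on {k..L}. v k = k + l}" using Suc by simp
  moreover have "bij_betw (hecke (k + l)) {v \<in> involutions_on {k..L}. v k = k + l}
    {v \<in> involutions_on {k..L}. v k = k + Suc l}"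
    using Suc by (intro hecke_arc_step) simp_all
  ultimately show ?case unfolding eq by (rule bij_betw_trans)
qed

lemma layout_perm_in_involutions_on:
  "spaced lo L ks \<Longrightarrow> layout_perm ks \<in> involutions_on {lo..L}"
  using rsf_word_bounds[of lo L ks] by (intro word_perm_in_involutions_on) fastforce

lemma layout_perm_Cons:
  "layout_perm ((k, l) # ks) = foldr hecke (rev [k..<k + l]) (layout_perm ks)"
  by (simp add: word_perm_append)

lemma layout_perm_first:
  assumes "spaced lo L ((k, l) # ks)"
  shows "layout_perm ((k, l) # ks) \<in> involutions_on {k..L}" "layout_perm ((k, l) # ks) k = k + l"
proof -
  have "layout_perm ks \<in> involutions_on {k + 2..L}" "1 \<le> l" "k + l \<le> L"
    using assms layout_perm_in_involutions_on by auto
  then have "layout_perm ((k, l) # ks) \<in> {v \<in> involutions_on {k..L}. v k = k + l}"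
    unfolding layout_perm_Cons using bij_betwE[OF hecke_arc] by blast
  then show "layout_perm ((k, l) # ks) \<in> involutions_on {k..L}" "layout_perm ((k, l) # ks) k = k + l"
    by simp_all
qed

text \<open>The first label can be read off: \<open>k\<close> is the least point that moves, and
  \<open>k + l\<close> is its image. Injectivity of the chain action then cancels the chain.\<close>

lemma layout_perm_inj:
  "spaced lo L ks \<Longrightarrow> spaced lo L ks' \<Longrightarrow> layout_perm ks = layout_perm ks' \<Longrightarrow> ks = ks'"
proof (induction ks arbitrary: lo ks')
  case Nil
  show ?case
  proof (cases ks')
    case (Cons y R)
    obtain k l where y: "y = (k, l)" by force
    then have sp: "spaced lo L ((k, l) # R)" using Cons Nil.prems(2) by simp
    have "layout_perm ((k, l) # R) = layout_perm []"
      using Nil.prems(3)[symmetric] unfolding Cons y .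
    then have "layout_perm ((k, l) # R) = id" by (simp only: rsf_word_simps word_perm_Nil)
    with layout_perm_first(2)[OF sp] sp show ?thesis by (simp only: id_apply) simp
  qed simp
next
  case (Cons x R)
  obtain k l where x: "x = (k, l)" by force
  note first = layout_perm_first[OF Cons.prems(1)[unfolded x]]
  have l: "1 \<le> l" "k + l \<le> L" "spaced (k + 2) L R" using Cons.prems(1) x by auto
  obtain k' l' R' where ks': "ks' = (k', l') # R'"
  proof (cases ks')
    case Nil
    with first(2) Cons.prems(3) l x show ?thesis by simp
  next
    case (Cons y R')
    then show ?thesis using that by (cases y) auto
  qed
  note first' = layout_perm_first[OF Cons.prems(2)[unfolded ks']]
  have l': "1 \<le> l'" "k' + l' \<le> L" "spaced (k' + 2) L R'" using Cons.prems(2) ks' by auto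
  have eq: "layout_perm ((k, l) # R) = layout_perm ((k', l') # R')" using Cons.prems(3) x ks' by simp
  have "layout_perm ((k, l) # R) y = y" if "y < k" for y
    using first(1) that by (simp add: involutions_on_def permutes_def)
  moreover have "layout_perm ((k', l') # R') y = y" if "y < k'" for y
    using first'(1) that by (simp add: involutions_on_def permutes_def)
  ultimately have k: "k' = k"
    using first(2) first'(2) eq l(1) l'(1) by (metis add_cancel_right_right not_less_iff_gr_or_eq not_one_le_zero)
  then have l_eq: "l' = l" using first(2) first'(2) eq by simp
  have "layout_perm R = layout_perm R'"
    using hecke_arc[OF l(1,2)] eq layout_perm_in_involutions_on[OF l(3)] layout_perm_in_involutions_on[OF l'(3)]
    unfolding layout_perm_Cons k l_eq by (auto simp: bij_betw_def dest: inj_onD)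
  then have "R = R'" using Cons.IH l(3) l'(3) k by blast
  then show ?case using x ks' k l_eq by simp
qed

text \<open>The same reading as a recursion: a fixed least point is skipped, otherwise its image
  gives the length of the first chain.\<close>

lemma layout_perm_surj:
  "u \<in> involutions_on {lo..L} \<Longrightarrow> \<exists>ks. spaced lo L ks \<and> layout_perm ks = u"
proof (induction "L + 1 - lo" arbitrary: lo u rule: less_induct)
  case less
  show ?case
  proof (cases "L < lo")
    case True
    then have "u = id" using less.prems by (simp add: involutions_on_def)
    then show ?thesis by (intro exI[of _ "[]"]) simp
  next
    case False
    show ?thesis
    proof (cases "u lo = lo")
      case True
      have "u \<in> involutions_on {lo + 1..L}"
        using less.prems by (rule involutions_on_shrink) (use True in \<open>auto simp: le_Suc_eq not_less_eq_eq\<close>)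
      moreover have "L + 1 - (lo + 1) < L + 1 - lo" using False by linarith
      ultimately obtain ks where "spaced (lo + 1) L ks" "layout_perm ks = u" using less.hyps by blast
      then show ?thesis using spaced_mono by (metis le_add1)
    next
      case neq: False
      have "u lo \<in> {lo..L}"
        by (subst permutes_in_image[of u]) (use less.prems False in \<open>auto simp: involutions_on_def\<close>)
      then obtain l where l: "u lo = lo + l" "1 \<le> l" "lo + l \<le> L"
        using neq by (metis One_nat_def Suc_leI add_cancel_right_right atLeastAtMost_iff le_iff_add neq0_conv)
      then have "u \<in> {v \<in> involutions_on {lo..L}. v lo = lo + l}" using less.prems by simp
      then obtain w where w: "w \<in> involutions_on {lo + 2..L}" "u = foldr hecke (rev [lo..<lo + l]) w"
        using hecke_arc[OF l(2,3)] unfolding bij_betw_def by blast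
      have "L + 1 - (lo + 2) < L + 1 - lo" using False by linarith
      with w(1) obtain ks where "spaced (lo + 2) L ks" "layout_perm ks = w" using less.hyps by blast
      with l w show ?thesis
        by (intro exI[of _ "(lo, l) # ks"]) (simp add: layout_perm_Cons del: rsf_word_simps)
    qed
  qed
qed

lemma layout_perm_bij: "bij_betw layout_perm (rsf_layouts L) (involutions_on {1..L})"
  unfolding bij_betw_def rsf_layouts_eq
proof
  show "inj_on layout_perm {ks. spaced 1 L ks}"
    by (intro inj_onI) (auto intro: layout_perm_inj)
  show "layout_perm ` {ks. spaced 1 L ks} = involutions_on {1..L}"
    using layout_perm_in_involutions_on[of 1 L] layout_perm_surj[of _ 1 L] by blast
qed

lemma finite_involutions_on: "finite A \<Longrightarrow> finite (involutions_on A)"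
  by (rule finite_subset[OF _ finite_permutations]) (auto simp: involutions_on_def)

lemma finite_rsf_layouts: "finite (rsf_layouts L)"
  using bij_betw_finite[OF layout_perm_bij] finite_involutions_on by blast

lemma Nil_in_rsf_layouts: "[] \<in> rsf_layouts L"
  by (simp add: rsf_layouts_eq)

section \<open>Absorption and disentangling as moves between partners\<close>

lemma layout_perm_eq_iff:
  "ks \<in> rsf_layouts L \<Longrightarrow> ks' \<in> rsf_layouts L \<Longrightarrow> layout_perm ks = layout_perm ks' \<longleftrightarrow> ks = ks'"
  using layout_perm_inj[of 1 L] by (auto simp: rsf_layouts_eq)

lemma layout_perm_involution: "\<forall>x. layout_perm ks (layout_perm ks x) = x"
  using word_perm_in_involutions_on[of _ UNIV] by (simp add: involutions_on_def)

lemma absorb_props: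
  assumes ks: "ks \<in> rsf_layouts L" and q: "1 \<le> q" "q < L"
  shows absorb_in_rsf_layouts: "absorb L q ks \<in> rsf_layouts L"
    and layout_perm_absorb: "layout_perm (absorb L q ks) = hecke q (layout_perm ks)"
    and length_absorb: "absorb L q ks = ks \<or> length (rsf_word (absorb L q ks)) = length (rsf_word ks) + 1"
proof -
  have start: "marked (rsf_word []) q (rsf_word ks) = New q # map Old (rsf_word ks)"
    by (simp add: marked_def)
  obtain r where r: "r \<in> rsf_layouts L" "reaches Step1 (New q # map Old (rsf_word ks)) r"
      "r = ks \<or> length (rsf_word r) = length (rsf_word ks) + 1"
    using reaches_total[of L "[]" ks q] ks q unfolding start by (auto simp: rsf_layouts_eq)
  have perm: "layout_perm ks' = hecke q (layout_perm ks)" if "absorbs L q ks ks'" for ks'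
  proof -
    from that obtain v where v: "run Step1 (New q # map Old (rsf_word ks)) v"
      "exchange id (map bond v) (rsf_word ks')" by (auto simp: absorbs_def)
    from exchange_word_perm[OF v(2)] run_word_perm[OF v(1)] show ?thesis by (simp add: comp_def)
  qed
  have a: "absorbs L q ks r" using r by (auto simp: absorbs_def reaches_def)
  moreover have "ks' = r" if "absorbs L q ks ks'" for ks'
    using perm[OF that] perm[OF a] that r(1) layout_perm_eq_iff[of ks' L r] by (simp add: absorbs_def)
  ultimately have "absorb L q ks = r" unfolding absorb_def by (rule the_equality)
  then show "absorb L q ks \<in> rsf_layouts L" "layout_perm (absorb L q ks) = hecke q (layout_perm ks)"
    "absorb L q ks = ks \<or> length (rsf_word (absorb L q ks)) = length (rsf_word ks) + 1"
    using r perm[OF a] by simp_all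
qed

definition flip :: "nat \<Rightarrow> nat \<Rightarrow> layout \<Rightarrow> layout" where
  "flip L b ks = inv_into (rsf_layouts L) layout_perm (partner b (layout_perm ks))"

lemma flip_props:
  assumes "ks \<in> rsf_layouts L" "1 \<le> b" "b < L"
  shows flip_in_rsf_layouts: "flip L b ks \<in> rsf_layouts L"
    and layout_perm_flip: "layout_perm (flip L b ks) = partner b (layout_perm ks)"
proof -
  have "layout_perm ks \<in> involutions_on {1..L}"
    using assms bij_betwE[OF layout_perm_bij] by blast
  then have "partner b (layout_perm ks) \<in> layout_perm ` rsf_layouts L"
    using assms layout_perm_bij[of L] by (auto simp: bij_betw_def intro!: partner_in_involutions_on)
  then show "flip L b ks \<in> rsf_layouts L" "layout_perm (flip L b ks) = partner b (layout_perm ks)"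
    unfolding flip_def by (rule inv_into_into, rule f_inv_into_f)
qed

lemma flip_flip:
  assumes "ks \<in> rsf_layouts L" "1 \<le> b" "b < L"
  shows "flip L b (flip L b ks) = ks"
  using assms flip_props[OF assms] flip_props[of "flip L b ks" L b]
  by (metis layout_perm_eq_iff partner_partner)

lemma flip_bij: "1 \<le> b \<Longrightarrow> b < L \<Longrightarrow> bij_betw (flip L b) (rsf_layouts L) (rsf_layouts L)"
  by (rule bij_betw_byWitness[where f' = "flip L b"])
    (auto simp: flip_flip flip_in_rsf_layouts)

text \<open>The ascent test at \<open>b\<close> decides. At an ascent absorption moves to the
  partner and no layout qualifies for the disentangler; at a descent absorption does nothing and the
  partner is the one source. The gate count rules out the source \<open>ks' = ks\<close>.\<close>

lemma game_moves:
  assumes ks: "ks \<in> rsf_layouts L" and b: "1 \<le> b" "b < L"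
  shows "(absorb L b ks = flip L b ks \<and> disentangle L b ks = ks) \<or>
    (absorb L b ks = ks \<and> disentangle L b ks = flip L b ks)"
proof (cases "layout_perm ks b < layout_perm ks (Suc b)")
  case True
  then have "layout_perm (absorb L b ks) = layout_perm (flip L b ks)"
    using assms by (simp add: layout_perm_absorb layout_perm_flip hecke_eq_partner layout_perm_involution)
  then have "absorb L b ks = flip L b ks"
    using assms by (simp add: layout_perm_eq_iff[of _ L] absorb_in_rsf_layouts flip_in_rsf_layouts)
  moreover have "\<not> disentangles L b ks ks'" for ks'
  proof
    assume d: "disentangles L b ks ks'"
    then have ks': "ks' \<in> rsf_layouts L" "absorb L b ks' = ks" "ks' \<noteq> ks" by (auto simp: disentangles_def)
    then have "layout_perm ks = hecke b (layout_perm ks')" using b layout_perm_absorb by metis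
    moreover have "layout_perm ks \<noteq> layout_perm ks'" using ks ks' layout_perm_eq_iff by metis
    ultimately show False
      using True hecke_ne_imp_partner(2)[OF layout_perm_involution[of ks'], of b] by simp
  qed
  ultimately show ?thesis by (simp add: disentangle_def)
next
  case False
  then have "layout_perm (absorb L b ks) = layout_perm ks"
    using assms by (simp add: layout_perm_absorb hecke_eq_partner layout_perm_involution)
  then have a: "absorb L b ks = ks"
    using assms by (simp add: layout_perm_eq_iff[of _ L] absorb_in_rsf_layouts)
  let ?f = "flip L b ks"
  note f = flip_props[OF assms]
  have asc: "layout_perm ?f b < layout_perm ?f (Suc b)"
    using False partner_ascent_iff[OF layout_perm_involution] f(2) by simp
  have "layout_perm (absorb L b ?f) = hecke b (layout_perm ?f)" using b f(1) by (rule layout_perm_absorb[rotated])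
  also have "\<dots> = partner b (layout_perm ?f)" using asc hecke_eq_partner[OF layout_perm_involution] by simp
  also have "\<dots> = layout_perm ks" by (simp add: f(2) partner_partner)
  finally have "layout_perm (absorb L b ?f) = layout_perm ks" .
  then have af: "absorb L b ?f = ks"
    using b ks f(1) by (simp add: layout_perm_eq_iff[of _ L] absorb_in_rsf_layouts)
  \<comment> \<open>Since the layouts differ, \<open>ks\<close> has exactly one gate more than
    \<open>?f\<close>.\<close>
  moreover have "?f \<noteq> ks" using asc False by metis
  ultimately have d: "disentangles L b ks ?f"
    using length_absorb[OF f(1) b] f(1) by (auto simp: disentangles_def)
  moreover have "ks' = ?f" if "disentangles L b ks ks'" for ks'
  proof -
    from that have ks': "ks' \<in> rsf_layouts L" "absorb L b ks' = ks" "ks' \<noteq> ks" by (auto simp: disentangles_def)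
    then have h: "layout_perm ks = hecke b (layout_perm ks')" using b layout_perm_absorb by metis
    moreover have "layout_perm ks \<noteq> layout_perm ks'" using ks ks' layout_perm_eq_iff by metis
    ultimately have "layout_perm ks' = layout_perm ?f"
      using hecke_ne_imp_partner(1)[OF layout_perm_involution[of ks'], of b] f(2) by simp
    then show ?thesis using ks' f(1) layout_perm_eq_iff by metis
  qed
  ultimately have "(THE ks'. disentangles L b ks ks') = ?f" by (rule the_equality)
  then have "disentangle L b ks = ?f" unfolding disentangle_def using d by (simp only: if_P[OF exI])
  with a show ?thesis by simp
qed

section \<open>The Markov chain\<close>

lemma pmf_bind_finite:
  assumes "finite S" "set_pmf p \<subseteq> S"
  shows "pmf (bind_pmf p K) y = (\<Sum>x\<in>S. pmf p x * pmf (K x) y)"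
  unfolding pmf_bind using assms by (subst integral_measure_pmf[of S]) auto

definition pmf_dist :: "'a set \<Rightarrow> 'a pmf \<Rightarrow> 'a pmf \<Rightarrow> real" where
  "pmf_dist S p q = (\<Sum>x\<in>S. \<bar>pmf p x - pmf q x\<bar>)"

text \<open>The differences of two distributions sum to zero, so the amount
  \<open>\<epsilon>\<close> at \<open>z\<close> can be subtracted from every row of the kernel
  without effect. What remains is nonnegative with row sums \<open>1 - \<epsilon>\<close>.\<close>

lemma pmf_dist_contract:
  assumes S: "finite S" "set_pmf p \<subseteq> S" "set_pmf q \<subseteq> S" "z \<in> S"
    and K: "\<And>x. x \<in> S \<Longrightarrow> set_pmf (K x) \<subseteq> S" "\<And>x. x \<in> S \<Longrightarrow> \<epsilon> \<le> pmf (K x) z" and \<epsilon>: "0 \<le> \<epsilon>"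
  shows "pmf_dist S (bind_pmf p K) (bind_pmf q K) \<le> (1 - \<epsilon>) * pmf_dist S p q"
proof -
  let ?d = "\<lambda>x. pmf p x - pmf q x" and ?e = "\<lambda>y. if y = z then \<epsilon> else 0"
  have sum_d: "(\<Sum>x\<in>S. ?d x) = 0"
    using S by (simp add: sum_subtractf sum_pmf_eq_1)
  have "\<bar>pmf (bind_pmf p K) y - pmf (bind_pmf q K) y\<bar> \<le> (\<Sum>x\<in>S. \<bar>?d x\<bar> * (pmf (K x) y - ?e y))"
    if y: "y \<in> S" for y
  proof -
    have "pmf (bind_pmf p K) y - pmf (bind_pmf q K) y = (\<Sum>x\<in>S. ?d x * pmf (K x) y) - (\<Sum>x\<in>S. ?d x) * ?e y"
      using S by (simp add: pmf_bind_finite[of S] sum_subtractf left_diff_distrib sum_pmf_eq_1)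
    also have "\<dots> = (\<Sum>x\<in>S. ?d x * (pmf (K x) y - ?e y))"
      by (simp only: sum_distrib_right sum_subtractf[symmetric] right_diff_distrib)
    also have "\<bar>\<dots>\<bar> \<le> (\<Sum>x\<in>S. \<bar>?d x * (pmf (K x) y - ?e y)\<bar>)" by (rule sum_abs)
    also have "\<dots> = (\<Sum>x\<in>S. \<bar>?d x\<bar> * (pmf (K x) y - ?e y))"
      by (intro sum.cong refl) (auto simp: abs_mult K(2))
    finally show ?thesis .
  qed
  then have "pmf_dist S (bind_pmf p K) (bind_pmf q K) \<le> (\<Sum>y\<in>S. \<Sum>x\<in>S. \<bar>?d x\<bar> * (pmf (K x) y - ?e y))"
    unfolding pmf_dist_def by (rule sum_mono)
  also have "\<dots> = (\<Sum>x\<in>S. \<bar>?d x\<bar> * (\<Sum>y\<in>S. pmf (K x) y - ?e y))"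
    by (subst sum.swap) (simp only: sum_distrib_left)
  also have "\<dots> = (\<Sum>x\<in>S. \<bar>?d x\<bar> * (1 - \<epsilon>))"
    using S K(1) by (intro sum.cong refl) (simp add: sum_subtractf sum_pmf_eq_1)
  also have "\<dots> = (1 - \<epsilon>) * pmf_dist S p q"
    by (simp add: pmf_dist_def sum_distrib_left mult.commute)
  finally show ?thesis .
qed

definition iterate :: "('a \<Rightarrow> 'a pmf) \<Rightarrow> nat \<Rightarrow> 'a pmf \<Rightarrow> 'a pmf" where
  "iterate K t = (\<lambda>p. bind_pmf p K) ^^ t"

lemma iterate_0 [simp]: "iterate K 0 p = p"
  and iterate_Suc: "iterate K (Suc t) p = bind_pmf (iterate K t p) K"
  by (simp_all add: iterate_def)

lemma iterate_add: "iterate K (s + t) p = iterate K s (iterate K t p)"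
  by (simp add: iterate_def funpow_add)

lemma iterate_bind: "iterate K t p = bind_pmf p (\<lambda>x. iterate K t (return_pmf x))"
  by (induction t) (simp_all add: iterate_Suc bind_assoc_pmf bind_return_pmf')

lemma iterate_Suc_return: "iterate K (Suc t) (return_pmf x) = bind_pmf (K x) (\<lambda>y. iterate K t (return_pmf y))"
  using iterate_add[of K t 1 "return_pmf x"] iterate_bind[of K t "K x"] by (simp add: iterate_Suc bind_return_pmf)

lemma set_iterate:
  assumes "\<And>x. x \<in> S \<Longrightarrow> set_pmf (K x) \<subseteq> S" "set_pmf p \<subseteq> S"
  shows "set_pmf (iterate K t p) \<subseteq> S"
  using assms by (induction t) (auto simp: iterate_Suc)

text \<open>Doeblin's condition: some state is reached from everywhere in the same number of steps.\<close>

lemma iterate_tendsto: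
  assumes S: "finite S" "z \<in> S" and K: "\<And>x. x \<in> S \<Longrightarrow> set_pmf (K x) \<subseteq> S"
    and \<pi>: "set_pmf \<pi> \<subseteq> S" "bind_pmf \<pi> K = \<pi>"
    and \<epsilon>: "0 < \<epsilon>" "\<And>x. x \<in> S \<Longrightarrow> \<epsilon> \<le> pmf (iterate K N (return_pmf x)) z"
    and p: "set_pmf p \<subseteq> S"
  shows "(\<lambda>t. pmf (iterate K t p) y) \<longlonglongrightarrow> pmf \<pi> y"
proof -
  have inv: "iterate K t \<pi> = \<pi>" for t by (induction t) (simp_all add: iterate_Suc \<pi>)
  define D where "D t = pmf_dist S (iterate K t p) \<pi>" for t
  have set: "set_pmf q \<subseteq> S \<Longrightarrow> set_pmf (iterate K t q) \<subseteq> S" for q t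
    using set_iterate[of S K q t] K by blast
  have D_nonneg: "0 \<le> D t" for t by (simp add: D_def pmf_dist_def sum_nonneg)
  \<comment> \<open>With constant 0 the contraction still says that a single step never increases
    the distance; this covers the times between multiples of \<open>N\<close>.\<close>
  have "D (Suc t) \<le> D t" for t
    using pmf_dist_contract[of S "iterate K t p" \<pi> z K 0] S K \<pi> set[OF p]
    by (simp add: D_def iterate_Suc)
  then have dec: "decseq D" by (simp add: decseq_Suc_iff)
  have contract: "D (t + N) \<le> (1 - \<epsilon>) * D t" for t
  proof -
    let ?Q = "\<lambda>x. iterate K N (return_pmf x)"
    have "pmf_dist S (bind_pmf (iterate K t p) ?Q) (bind_pmf \<pi> ?Q) \<le> (1 - \<epsilon>) * D t"
      unfolding D_def using S \<epsilon> \<pi> set[OF p] set[of "return_pmf _"]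
      by (intro pmf_dist_contract[of S _ \<pi> z]) auto
    moreover have "bind_pmf (iterate K t p) ?Q = iterate K (t + N) p"
      unfolding add.commute[of t N] iterate_add by (rule iterate_bind[symmetric])
    moreover have "bind_pmf \<pi> ?Q = \<pi>"
      using iterate_bind[of K N \<pi>, symmetric] unfolding inv .
    ultimately show ?thesis by (simp only: D_def)
  qed
  have eps1: "\<epsilon> \<le> 1" using order_trans[OF \<epsilon>(2)[OF S(2)] pmf_le_1] .
  have geometric: "D (N * j) \<le> (1 - \<epsilon>) ^ j * D 0" for j
  proof (induction j)
    case (Suc j)
    have "D (N * Suc j) \<le> (1 - \<epsilon>) * D (N * j)" using contract[of "N * j"] by (simp add: add.commute)
    also have "\<dots> \<le> (1 - \<epsilon>) * ((1 - \<epsilon>) ^ j * D 0)" using Suc eps1 by (intro mult_left_mono) auto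
    finally show ?case by simp
  qed simp
  have lim: "(\<lambda>j. (1 - \<epsilon>) ^ j * D 0) \<longlonglongrightarrow> 0 * D 0"
    using \<epsilon>(1) eps1 by (intro tendsto_mult_right LIMSEQ_realpow_zero) auto
  have "D \<longlonglongrightarrow> 0"
  proof (rule LIMSEQ_I)
    fix r :: real assume "0 < r"
    from LIMSEQ_D[OF lim this] obtain j where "norm ((1 - \<epsilon>) ^ j * D 0 - 0 * D 0) < r" by blast
    then have "(1 - \<epsilon>) ^ j * D 0 < r" by simp
    then have "D (N * j) < r" using geometric[of j] by linarith
    then have "\<forall>t\<ge>N * j. norm (D t - 0) < r" using dec D_nonneg by (auto simp: decseq_def intro: le_less_trans)
    then show "\<exists>no. \<forall>t\<ge>no. norm (D t - 0) < r" by blast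
  qed
  have "\<bar>pmf (iterate K t p) y - pmf \<pi> y\<bar> \<le> D t" for t
  proof (cases "y \<in> S")
    case True
    then show ?thesis unfolding D_def pmf_dist_def
      by (intro member_le_sum[of y S "\<lambda>y. \<bar>pmf (iterate K t p) y - pmf \<pi> y\<bar>"]) (auto simp: S)
  next
    case False
    then have "pmf (iterate K t p) y = 0" "pmf \<pi> y = 0"
      using set[OF p, of t] \<pi> by (auto simp: set_pmf_eq)
    then show ?thesis using D_nonneg by simp
  qed
  then have "(\<lambda>t. pmf (iterate K t p) y - pmf \<pi> y) \<longlonglongrightarrow> 0"
    by (intro Lim_null_comparison[OF _ \<open>D \<longlonglongrightarrow> 0\<close>]) auto
  then show ?thesis by (simp add: LIM_zero_iff)
qed

text \<open>Here p = 1/2 enters: a fair coin does not see which of its outcomes absorbs and which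
  disentangles.\<close>

lemma bernoulli_half_swap:
  "bind_pmf (bernoulli_pmf (1 / 2)) (\<lambda>d. return_pmf (if d then x else y)) =
   bind_pmf (bernoulli_pmf (1 / 2)) (\<lambda>d. return_pmf (if d then y else x))"
  by (rule pmf_eqI) (simp add: pmf_bind)

lemma game_step_eq_flip:
  assumes "2 \<le> L" "ks \<in> rsf_layouts L"
  shows "game_step L (1 / 2) ks =
    bind_pmf (pmf_of_set {1..L - 1}) (\<lambda>b. bind_pmf (bernoulli_pmf (1 / 2))
      (\<lambda>d. return_pmf (if d then flip L b ks else ks)))"
  unfolding game_step_def
proof (rule bind_pmf_cong[OF refl])
  fix b assume "b \<in> set_pmf (pmf_of_set {1..L - 1})"
  then have b: "1 \<le> b" "b < L" using assms by auto
  show "bind_pmf (bernoulli_pmf (1 / 2)) (\<lambda>d. return_pmf (if d then disentangle L b ks else absorb L b ks)) =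
    bind_pmf (bernoulli_pmf (1 / 2)) (\<lambda>d. return_pmf (if d then flip L b ks else ks))"
    using game_moves[OF assms(2) b]
  proof (elim disjE conjE)
    assume moves: "absorb L b ks = flip L b ks" "disentangle L b ks = ks"
    show ?thesis unfolding moves by (rule bernoulli_half_swap)
  next
    assume moves: "absorb L b ks = ks" "disentangle L b ks = flip L b ks"
    show ?thesis unfolding moves ..
  qed
qed

lemma set_game_step:
  assumes "2 \<le> L" "ks \<in> rsf_layouts L"
  shows "set_pmf (game_step L (1 / 2) ks) \<subseteq> rsf_layouts L"
  using assms by (auto simp: game_step_eq_flip intro!: flip_in_rsf_layouts split: if_splits)

text \<open>With bond and coin drawn first, the update is the identity or the bijection
  \<open>flip L b\<close>.\<close>

lemma uniform_invariant:
  assumes "2 \<le> L"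
  shows "bind_pmf (pmf_of_set (rsf_layouts L)) (game_step L (1 / 2)) = pmf_of_set (rsf_layouts L)"
proof -
  let ?u = "pmf_of_set (rsf_layouts L)" and ?B = "pmf_of_set {1..L - 1}"
  have ne: "rsf_layouts L \<noteq> {}" using Nil_in_rsf_layouts by blast
  have u: "bind_pmf ?u (\<lambda>ks. return_pmf (if d then flip L b ks else ks)) = ?u" if "b \<in> set_pmf ?B" for b d
  proof -
    have b: "1 \<le> b" "b < L" using that assms by auto
    show ?thesis
      using map_pmf_of_set_bij_betw[OF flip_bij[OF b] ne finite_rsf_layouts]
      by (cases d) (simp_all add: map_pmf_def[symmetric] bind_return_pmf')
  qed
  have "bind_pmf ?u (game_step L (1 / 2)) =
    bind_pmf ?u (\<lambda>ks. bind_pmf ?B (\<lambda>b. bind_pmf (bernoulli_pmf (1 / 2))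
      (\<lambda>d. return_pmf (if d then flip L b ks else ks))))"
    using assms ne finite_rsf_layouts by (intro bind_pmf_cong refl game_step_eq_flip) auto
  also have "\<dots> = bind_pmf ?B (\<lambda>b. bind_pmf (bernoulli_pmf (1 / 2))
      (\<lambda>d. bind_pmf ?u (\<lambda>ks. return_pmf (if d then flip L b ks else ks))))"
    by (subst bind_commute_pmf) (subst (2) bind_commute_pmf, rule refl)
  also have "\<dots> = bind_pmf ?B (\<lambda>b. ?u)"
    by (intro bind_pmf_cong refl) (simp add: u)
  finally show ?thesis by simp
qed

text \<open>Waiting in place excludes periodicity and lets paths of different lengths end at a
  common time.\<close>

lemma game_step_stay:
  assumes "2 \<le> L" "ks \<in> rsf_layouts L"
  shows "1 / 2 \<le> pmf (game_step L (1 / 2) ks) ks"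
proof -
  let ?B = "pmf_of_set {1..L - 1}"
  have half: "1 / 2 \<le> pmf (bind_pmf (bernoulli_pmf (1 / 2)) (\<lambda>d. return_pmf (if d then flip L b ks else ks))) ks" for b
    by (simp add: pmf_bind)
  have "1 / 2 = (\<integral>b. (1 / 2 :: real) \<partial>measure_pmf ?B)" by simp
  also have "\<dots> \<le> (\<integral>b. pmf (bind_pmf (bernoulli_pmf (1 / 2))
      (\<lambda>d. return_pmf (if d then flip L b ks else ks))) ks \<partial>measure_pmf ?B)"
    by (intro integral_mono measure_pmf.integrable_const_bound[where B = 1])
      (rule half | simp add: pmf_le_1)+
  finally show ?thesis using assms by (simp add: game_step_eq_flip pmf_bind)
qed

text \<open>Bond \<open>b\<close> has probability \<open>1 / (L - 1)\<close>, the coin contributes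
  1/2. Other bonds may lead to the same layout, hence only a bound.\<close>

lemma game_step_flip:
  assumes "2 \<le> L" "ks \<in> rsf_layouts L" "1 \<le> b" "b < L"
  shows "1 / (2 * real (L - 1)) \<le> pmf (game_step L (1 / 2) ks) (flip L b ks)"
proof -
  let ?f = "\<lambda>b'. pmf (bind_pmf (bernoulli_pmf (1 / 2)) (\<lambda>d. return_pmf (if d then flip L b' ks else ks))) (flip L b ks)"
  have B: "{1..L - 1} \<noteq> {}" "finite {1..L - 1}" "b \<in> {1..L - 1}" using assms by auto
  have "1 / 2 \<le> ?f b" by (simp add: pmf_bind)
  also have "\<dots> \<le> (\<Sum>b'\<in>{1..L - 1}. ?f b')"
    using B by (intro member_le_sum) auto
  finally have "1 / 2 / real (L - 1) \<le> (\<Sum>b'\<in>{1..L - 1}. ?f b') / real (L - 1)"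
    by (rule divide_right_mono) simp
  also have "\<dots> = pmf (game_step L (1 / 2) ks) (flip L b ks)"
    unfolding game_step_eq_flip[OF assms(1,2)] by (subst pmf_bind_pmf_of_set[OF B(1,2)]) simp
  finally show ?thesis by simp
qed

text \<open>The witness is the bond of the gate applied last.\<close>

lemma flip_removes_gate:
  assumes "ks \<in> rsf_layouts L" "ks \<noteq> []"
  shows "\<exists>b. 1 \<le> b \<and> b < L \<and> length (rsf_word (flip L b ks)) < length (rsf_word ks)"
proof -
  obtain k l R where ks: "ks = (k, l) # R" using assms(2) by (metis list.exhaust surj_pair)
  have sp: "1 \<le> k" "1 \<le> l" "k + l \<le> L" "spaced (k + 2) L R"
    using assms(1) by (auto simp: ks rsf_layouts_eq)
  define b where "b = k + l - 1"
  define ks' where "ks' = (if l = 1 then R else (k, l - 1) # R)"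
  have b: "1 \<le> b" "b < L" using sp by (auto simp: b_def)
  have ks': "ks' \<in> rsf_layouts L"
    using sp spaced_mono[OF sp(4), of 1] by (auto simp: ks'_def rsf_layouts_eq)
  have word: "rsf_word ks = b # rsf_word ks'"
  proof -
    have "rev [k..<k + l] = b # rev [k..<k + (l - 1)]"
      using sp(2) by (cases l) (auto simp: b_def)
    then show ?thesis by (simp add: ks ks'_def)
  qed
  then have h: "layout_perm ks = hecke b (layout_perm ks')" by simp
  moreover have "ks \<noteq> ks'" using word by auto
  then have "layout_perm ks \<noteq> layout_perm ks'" using assms(1) ks' by (simp add: layout_perm_eq_iff)
  ultimately have "layout_perm ks' = partner b (layout_perm ks)"
    using hecke_ne_imp_partner(1)[OF layout_perm_involution[of ks'], of b] by simp
  then have "flip L b ks = ks'"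
    using assms(1) b ks' layout_perm_flip flip_in_rsf_layouts layout_perm_eq_iff by metis
  then show ?thesis using b word by auto
qed

text \<open>One gate is removed per step until none is left, then the chain waits; each of these
  steps has at least the probability of a prescribed flip.\<close>

lemma iterate_reaches_Nil:
  assumes L: "2 \<le> L" and ks: "ks \<in> rsf_layouts L" "length (rsf_word ks) \<le> t"
  shows "(1 / (2 * real (L - 1))) ^ t \<le> pmf (iterate (game_step L (1 / 2)) t (return_pmf ks)) []"
  using ks
proof (induction t arbitrary: ks)
  case 0
  then have "ks = []"
    by (cases ks) (auto simp: rsf_layouts_eq)
  then show ?case by simp
next
  case (Suc t)
  let ?K = "game_step L (1 / 2)" and ?\<delta> = "1 / (2 * real (L - 1))"
  obtain ks' where ks': "ks' \<in> rsf_layouts L" "length (rsf_word ks') \<le> t" "?\<delta> \<le> pmf (?K ks) ks'"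
  proof (cases "ks = []")
    case True
    have "?\<delta> \<le> 1 / 2" using L by (simp add: field_simps)
    then show ?thesis using game_step_stay[OF L Nil_in_rsf_layouts] True that[of "[]"] Nil_in_rsf_layouts by simp
  next
    case False
    with flip_removes_gate[OF Suc.prems(1)] obtain b where
      b: "1 \<le> b" "b < L" "length (rsf_word (flip L b ks)) < length (rsf_word ks)" by blast
    then show ?thesis
      using that[OF flip_in_rsf_layouts[OF Suc.prems(1) b(1,2)]] game_step_flip[OF L Suc.prems(1) b(1,2)] Suc.prems(2)
      by simp
  qed
  have "?\<delta> ^ Suc t \<le> pmf (?K ks) ks' * pmf (iterate ?K t (return_pmf ks')) []"
    using Suc.IH[OF ks'(1,2)] ks'(3) by (simp only: power_Suc) (intro mult_mono, auto)
  also have "\<dots> \<le> (\<Sum>x\<in>rsf_layouts L. pmf (?K ks) x * pmf (iterate ?K t (return_pmf x)) [])"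
    using ks'(1) by (intro member_le_sum) (auto simp: finite_rsf_layouts)
  also have "\<dots> = pmf (iterate ?K (Suc t) (return_pmf ks)) []"
    using set_game_step[OF L Suc.prems(1)]
    by (simp add: iterate_Suc_return pmf_bind_finite[OF finite_rsf_layouts])
  finally show ?case .
qed

lemma stationary_distribution_half:
  assumes L: "2 \<le> L"
  shows "stationary_distribution L (1 / 2) = pmf_of_set (rsf_layouts L)"
  unfolding stationary_distribution_def
proof (rule the_equality)
  let ?u = "pmf_of_set (rsf_layouts L)" and ?K = "game_step L (1 / 2)"
  have set_u: "set_pmf ?u = rsf_layouts L"
    using Nil_in_rsf_layouts finite_rsf_layouts by (subst set_pmf_of_set) auto
  \<comment> \<open>The largest gate count serves as the common number of steps.\<close>
  obtain N where N: "\<And>ks. ks \<in> rsf_layouts L \<Longrightarrow> length (rsf_word ks) \<le> N"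
    using finite_nat_set_iff_bounded_le[of "(length \<circ> rsf_word) ` rsf_layouts L"] finite_rsf_layouts by auto
  have "(\<lambda>t. pmf (evolve L (1 / 2) t ks) ks') \<longlonglongrightarrow> pmf ?u ks'" if "ks \<in> rsf_layouts L" for ks ks'
    unfolding evolve_def iterate_def[symmetric]
    using L that set_game_step uniform_invariant iterate_reaches_Nil N set_u
    by (intro iterate_tendsto[of "rsf_layouts L" "[]" ?K ?u "(1 / (2 * real (L - 1))) ^ N" N])
      (auto simp: finite_rsf_layouts Nil_in_rsf_layouts)
  then show u: "is_stationary_distribution L (1 / 2) ?u"
    using L by (auto simp: is_stationary_distribution_def set_u uniform_invariant)
  \<comment> \<open>The limits along the chain started at \<open>[]\<close> already determine a
    stationary distribution.\<close>
  show "\<pi> = ?u" if "is_stationary_distribution L (1 / 2) \<pi>" for \<pi>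
    using that u Nil_in_rsf_layouts unfolding is_stationary_distribution_def
    by (intro pmf_eqI) (meson LIMSEQ_unique)
qed

section \<open>Entropy and counting\<close>

definition arcs_across :: "(nat \<Rightarrow> nat) \<Rightarrow> nat \<Rightarrow> nat" where
  "arcs_across w n = card {i \<in> {1..n}. n < w i}"

text \<open>For \<open>n \<noteq> b\<close> the swapped points lie on the same side of the cut at
  \<open>n\<close>.\<close>

lemma arcs_across_relabel:
  assumes "1 \<le> b" "n \<noteq> b"
  shows "arcs_across (w \<circ> adj_swap b) n = arcs_across w n" "arcs_across (adj_swap b \<circ> w) n = arcs_across w n"
proof -
  have small: "adj_swap b i \<in> {1..n} \<longleftrightarrow> i \<in> {1..n}" for i
    using assms by (auto simp: Transposition.transpose_def)
  have big: "n < adj_swap b i \<longleftrightarrow> n < i" for i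
    using assms by (auto simp: Transposition.transpose_def)
  have "{i \<in> {1..n}. n < (w \<circ> adj_swap b) i} = adj_swap b ` {i \<in> {1..n}. n < w i}"
  proof safe
    fix i assume "i \<in> {1..n}" "n < (w \<circ> adj_swap b) i"
    then show "i \<in> adj_swap b ` {i \<in> {1..n}. n < w i}"
      using small[of i] by (intro image_eqI[of _ _ "adj_swap b i"]) simp_all
  qed (use small in simp_all)
  then show "arcs_across (w \<circ> adj_swap b) n = arcs_across w n" by (simp add: arcs_across_def card_image)
  show "arcs_across (adj_swap b \<circ> w) n = arcs_across w n" by (simp only: arcs_across_def comp_apply big)
qed

lemma arcs_across_hecke_other:
  assumes "\<forall>x. w (w x) = x" "1 \<le> b" "n \<noteq> b"
  shows "arcs_across (hecke b w) n = arcs_across w n"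
proof -
  have "arcs_across (partner b w) n = arcs_across w n"
  proof (cases "{w b, w (Suc b)} = {b, Suc b}")
    case True
    then have p: "partner b w = w \<circ> adj_swap b" by (rule partner_commuting)
    show ?thesis unfolding p by (rule arcs_across_relabel[OF assms(2,3)])
  next
    case False
    then have p: "partner b w = adj_swap b \<circ> w \<circ> adj_swap b" by (rule partner_conjugate)
    show ?thesis unfolding p by (simp only: arcs_across_relabel[OF assms(2,3)])
  qed
  then show ?thesis using assms(1) by (simp add: hecke_eq_partner)
qed

text \<open>Moving the cut over \<open>Suc n\<close> loses the arc that ends there or gains the arc
  that starts there. The additive form avoids natural subtraction, and \<open>w 0 = 0\<close> keeps
  0 from being an end of an arc.\<close>

lemma arcs_across_Suc:
  assumes inv: "\<forall>x. w (w x) = x" and "w 0 = 0"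
  shows "arcs_across w (Suc n) + (if w (Suc n) \<le> n then 1 else 0) = arcs_across w n + (if Suc n < w (Suc n) then 1 else 0)"
proof -
  let ?X = "{i \<in> {1..n}. Suc n < w i}"
  have "{i \<in> {1..Suc n}. Suc n < w i} = ?X \<union> (if Suc n < w (Suc n) then {Suc n} else {})"
    by (auto simp: le_Suc_eq)
  then have 1: "arcs_across w (Suc n) = card ?X + (if Suc n < w (Suc n) then 1 else 0)"
    by (simp add: arcs_across_def)
  have "w i = Suc n \<longleftrightarrow> i = w (Suc n)" for i using inv by metis
  moreover have "w (Suc n) \<noteq> 0" using assms by (metis nat.distinct(1))
  ultimately have "{i \<in> {1..n}. w i = Suc n} = (if w (Suc n) \<le> n then {w (Suc n)} else {})"
    by auto
  moreover have "{i \<in> {1..n}. n < w i} = ?X \<union> {i \<in> {1..n}. w i = Suc n}" by auto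
  ultimately have "{i \<in> {1..n}. n < w i} = ?X \<union> (if w (Suc n) \<le> n then {w (Suc n)} else {})"
    by simp
  moreover have "w (Suc n) \<notin> ?X" using inv by simp
  ultimately have "arcs_across w n = card ?X + (if w (Suc n) \<le> n then 1 else 0)"
    by (simp add: arcs_across_def)
  with 1 show ?thesis by simp
qed

text \<open>At a descent \<open>Suc n\<close> opens an arc or \<open>Suc (Suc n)\<close> closes one:
  if \<open>w (Suc n) \<le> Suc n\<close>, then \<open>w (Suc (Suc n)) \<le> n\<close>. As
  neighbouring counts differ by at most one, the middle one exceeds the smaller neighbour by
  one.\<close>

lemma arcs_across_descent:
  assumes "\<forall>x. w (w x) = x" "w 0 = 0" "w (Suc (Suc n)) < w (Suc n)"
  shows "arcs_across w (Suc n) = 1 + min (arcs_across w n) (arcs_across w (Suc (Suc n)))"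
  using arcs_across_Suc[OF assms(1,2), of n] arcs_across_Suc[OF assms(1,2), of "Suc n"] assms(3)
  by (auto split: if_splits)

text \<open>The result always has a descent at \<open>b\<close>, and the other counts do not change.
  Arc counts thus obey the very rule that genericity imposes on entropies.\<close>

lemma arcs_across_hecke_same:
  assumes inv: "\<forall>x. w (w x) = x" and "w 0 = 0" and b: "1 \<le> b"
  shows "arcs_across (hecke b w) b = 1 + min (arcs_across w (b - 1)) (arcs_across w (b + 1))"
proof -
  obtain n where n: "b = Suc n" using b by (cases b) auto
  let ?v = "hecke b w"
  have inv': "\<forall>x. ?v (?v x) = x"
    using hecke_eq_partner[OF inv, of b] partner_involution_iff[OF inv, of b] inv by simp
  have "?v 0 = 0"
    using hecke_eq_partner[OF inv, of b] \<open>w 0 = 0\<close> b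
    by (auto simp: partner_def Let_def Transposition.transpose_def)
  moreover have "?v (Suc b) < ?v b"
  proof -
    have "w b \<noteq> w (Suc b)" using inv by (metis n_not_Suc_n)
    moreover have "?v b \<noteq> ?v (Suc b)" using inv' by (metis n_not_Suc_n)
    ultimately show ?thesis
      using hecke_eq_partner[OF inv, of b] partner_ascent_iff[OF inv, of b]
      by (auto split: if_splits simp: not_less)
  qed
  ultimately have "arcs_across ?v b = 1 + min (arcs_across ?v n) (arcs_across ?v (Suc b))"
    using arcs_across_descent[OF inv', of n] n by simp
  then show ?thesis using arcs_across_hecke_other[OF inv b] n by simp
qed

section \<open>Entropy of circuit states\<close>

lemma finite_bits: "finite (bits n)"
  using finite_lists_length_eq[of "UNIV :: bool set" n] by (simp add: bits_def)

lemma zero_state_bits: "x \<in> bits n \<Longrightarrow> zero_state x = (if x = replicate n False then 1 else 0)"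
  by (auto simp: zero_state_def bits_def replicate_length_same[symmetric] intro!: replicate_eqI)

lemma zero_state_append: "zero_state (x @ y) = zero_state x * zero_state y"
  by (simp add: zero_state_def)

lemma sum_zero_state: "(\<Sum>x\<in>bits n. f x * zero_state x) = f (replicate n False)"
proof -
  have "(\<Sum>x\<in>bits n. f x * zero_state x) = (\<Sum>x\<in>bits n. if x = replicate n False then f x else 0)"
    by (intro sum.cong refl) (simp add: zero_state_bits)
  then show ?thesis by (simp add: finite_bits) (simp add: bits_def)
qed

lemma zero_state_replicate [simp]: "zero_state (replicate n False) = 1"
  by (simp add: zero_state_def)

text \<open>Contraction with \<open>u i\<close> makes every \<open>v i\<close> a multiple of
  \<open>zero_state\<close>, and an orthonormal family on one line has a single member. The rank
  being a definite description, this uniqueness gives the starting value of the entropy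
  recursion.\<close>

lemma schmidt_decomposition_zero_state:
  assumes "schmidt_decomposition L m zero_state r s u v"
  shows "r = 1"
proof -
  let ?x = "replicate m False" and ?y = "replicate (L - m) False"
  have pos: "\<And>i. i < r \<Longrightarrow> 0 < s i"
    and u: "\<And>i j. i < r \<Longrightarrow> j < r \<Longrightarrow> (\<Sum>x\<in>bits m. cnj (u i x) * u j x) = (if i = j then 1 else 0)"
    and v: "\<And>i j. i < r \<Longrightarrow> j < r \<Longrightarrow> (\<Sum>y\<in>bits (L - m). cnj (v i y) * v j y) = (if i = j then 1 else 0)"
    and eq: "\<And>x y. x \<in> bits m \<Longrightarrow> y \<in> bits (L - m) \<Longrightarrow>
      zero_state (x @ y) = (\<Sum>i<r. of_real (s i) * u i x * v i y)"
    using assms by (auto simp: schmidt_decomposition_def orthonormal_family_def)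
  define a where "a i = cnj (u i ?x) / of_real (s i)" for i
  have va: "v i y = a i * zero_state y" if i: "i < r" and y: "y \<in> bits (L - m)" for i y
  proof -
    have "cnj (u i ?x) * zero_state y = (\<Sum>x\<in>bits m. cnj (u i x) * zero_state y * zero_state x)"
      by (simp add: sum_zero_state)
    also have "\<dots> = (\<Sum>x\<in>bits m. cnj (u i x) * zero_state (x @ y))"
      by (simp add: zero_state_append mult_ac)
    also have "\<dots> = (\<Sum>x\<in>bits m. \<Sum>j<r. of_real (s j) * v j y * (cnj (u i x) * u j x))"
      using y by (intro sum.cong refl) (simp add: eq sum_distrib_left mult_ac)
    also have "\<dots> = (\<Sum>j<r. of_real (s j) * v j y * (\<Sum>x\<in>bits m. cnj (u i x) * u j x))"
      by (subst sum.swap) (simp add: sum_distrib_left)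
    also have "\<dots> = (\<Sum>j<r. if j = i then of_real (s j) * v j y else 0)"
      using i by (intro sum.cong refl) (auto simp: u)
    also have "\<dots> = of_real (s i) * v i y" using i by simp
    finally show ?thesis using pos[OF i] by (simp add: a_def field_simps)
  qed
  have orth: "cnj (a i) * a j = (if i = j then 1 else 0)" if "i < r" "j < r" for i j
  proof -
    have "(\<Sum>y\<in>bits (L - m). cnj (v i y) * v j y)
        = (\<Sum>y\<in>bits (L - m). (cnj (a i) * a j * cnj (zero_state y)) * zero_state y)"
      using that by (intro sum.cong refl) (simp add: va mult_ac)
    then show ?thesis using v[OF that] by (simp add: sum_zero_state)
  qed
  have "r \<noteq> 0"
  proof
    assume "r = 0"
    then show False using eq[of ?x ?y] by (simp add: bits_def zero_state_append)
  qed
  moreover have "\<not> 1 < r"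
  proof
    assume "1 < r"
    then show False using orth[of 0 0] orth[of 1 1] orth[of 0 1] by auto
  qed
  ultimately show ?thesis by simp
qed

lemma schmidt_rank_zero_state: "schmidt_rank L m zero_state = 1"
  unfolding schmidt_rank_def
proof (rule the_equality)
  have "orthonormal_family n 1 (\<lambda>_. zero_state)" for n
    using sum_zero_state[of "\<lambda>x. cnj (zero_state x)" n] by (simp add: orthonormal_family_def)
  then have "schmidt_decomposition L m zero_state 1 (\<lambda>_. 1) (\<lambda>_. zero_state) (\<lambda>_. zero_state)"
    by (simp add: schmidt_decomposition_def zero_state_append)
  then show "\<exists>s u v. schmidt_decomposition L m zero_state 1 s u v" by blast
qed (use schmidt_decomposition_zero_state in blast)

lemma renyi0_zero_state: "renyi0 L m zero_state = 0"
  by (simp add: renyi0_def schmidt_rank_zero_state)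

lemma word_perm_0:
  assumes "\<forall>b\<in>set bs. 1 \<le> b"
  shows "word_perm bs 0 = 0"
  using assms by (intro word_perm_vacuum) auto

lemma renyi0_circuit_state:
  assumes "generic_circuit L c" "\<forall>g\<in>set c. 1 \<le> gate_bond g \<and> gate_bond g < L" "n \<le> L"
  shows "renyi0 L n (circuit_state c) = arcs_across (word_perm (map gate_bond c)) n"
  using assms
proof (induction c arbitrary: n)
  case Nil
  then show ?case by (simp add: circuit_state_def renyi0_zero_state arcs_across_def)
next
  case (Cons g c)
  let ?b = "gate_bond g" and ?w = "word_perm (map gate_bond c)"
  have "generic_circuit L c"
    unfolding generic_circuit_def
  proof (intro allI impI)
    fix later h earlier assume "c = later @ h # earlier"
    then have "g # c = (g # later) @ h # earlier" by simp
    with Cons.prems(1) show "let b = gate_bond h; \<psi> = circuit_state earlier; \<psi>' = apply_gate h \<psi>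
      in renyi0 L b \<psi>' = 1 + min (renyi0 L (b - 1) \<psi>) (renyi0 L (b + 1) \<psi>)
        \<and> (\<forall>n\<le>L. n \<noteq> b \<longrightarrow> renyi0 L n \<psi>' = renyi0 L n \<psi>)"
      unfolding generic_circuit_def by blast
  qed
  then have IH: "renyi0 L n (circuit_state c) = arcs_across ?w n" if "n \<le> L" for n
    using Cons that by simp
  have b: "1 \<le> ?b" "?b < L" using Cons.prems by auto
  have "g # c = [] @ g # c" by simp
  with Cons.prems(1) have
    "renyi0 L ?b (apply_gate g (circuit_state c)) =
       1 + min (renyi0 L (?b - 1) (circuit_state c)) (renyi0 L (?b + 1) (circuit_state c))"
    "\<forall>n\<le>L. n \<noteq> ?b \<longrightarrow> renyi0 L n (apply_gate g (circuit_state c)) = renyi0 L n (circuit_state c)"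
    unfolding generic_circuit_def Let_def by blast+
  moreover have "circuit_state (g # c) = apply_gate g (circuit_state c)" by (simp add: circuit_state_def)
  ultimately have step:
    "renyi0 L ?b (circuit_state (g # c)) = 1 + min (real (arcs_across ?w (?b - 1))) (real (arcs_across ?w (?b + 1)))"
    "\<And>n. n \<le> L \<Longrightarrow> n \<noteq> ?b \<Longrightarrow> renyi0 L n (circuit_state (g # c)) = arcs_across ?w n"
    using b by (simp_all add: IH)
  have inv: "\<forall>x. ?w (?w x) = x"
    using word_perm_in_involutions_on[of _ UNIV] by (simp add: involutions_on_def)
  have "?w 0 = 0" using Cons.prems by (intro word_perm_0) auto
  show ?case
  proof (cases "n = ?b")
    case True
    then show ?thesis using step(1) arcs_across_hecke_same[OF inv \<open>?w 0 = 0\<close> b(1)] by (simp add: of_nat_min)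
  next
    case False
    then show ?thesis using step(2)[OF Cons.prems(3)] arcs_across_hecke_other[OF inv b(1)] by simp
  qed
qed

section \<open>Counting involutions\<close>

lemma involutions_on_fixed:
  assumes "i \<in> A"
  shows "{w \<in> involutions_on A. w i = i} = involutions_on (A - {i})"
proof (intro equalityI subsetI)
  fix w assume "w \<in> {w \<in> involutions_on A. w i = i}"
  then show "w \<in> involutions_on (A - {i})" by (auto elim!: involutions_on_shrink)
next
  fix w assume w: "w \<in> involutions_on (A - {i})"
  then show "w \<in> {w \<in> involutions_on A. w i = i}"
    using involutions_on_mono[OF w, of A] by (auto simp: involutions_on_def permutes_def)
qed

lemma card_involutions_pair:
  assumes "i \<in> A" "j \<in> A" "i \<noteq> j"
  shows "card {w \<in> involutions_on A. w i = j} = card (involutions_on (A - {i, j}))"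
proof (rule bij_betw_same_card[of "\<lambda>w. w \<circ> Transposition.transpose i j"],
    rule bij_betw_byWitness[where f' = "\<lambda>w. w \<circ> Transposition.transpose i j"])
  let ?t = "Transposition.transpose i j"
  let ?f = "\<lambda>w. w \<circ> ?t"
  show "\<forall>w\<in>{w \<in> involutions_on A. w i = j}. ?f (?f w) = w"
    "\<forall>w\<in>involutions_on (A - {i, j}). ?f (?f w) = w"
    by (simp_all add: comp_assoc)
  show "?f ` {w \<in> involutions_on A. w i = j} \<subseteq> involutions_on (A - {i, j})"
  proof safe
    fix w assume w: "w \<in> involutions_on A" "j = w i"
    then have inv: "w (w x) = x" for x by (simp add: involutions_on_def)
    have fixed: "(w \<circ> ?t) i = i" "(w \<circ> ?t) j = j" using w(2) inv[of i] by simp_all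
    have "(w \<circ> ?t) ((w \<circ> ?t) x) = x" for x
    proof (cases "x = i \<or> x = j")
      case False
      then have "w x \<noteq> i" "w x \<noteq> j" using inv[of x] inv[of i] w(2) by metis+
      then show ?thesis using False inv[of x] by (simp add: transpose_def)
    qed (use fixed in auto)
    moreover have "(w \<circ> ?t) permutes A"
      using w assms by (intro permutes_compose permutes_swap_id) (auto simp: involutions_on_def)
    ultimately have "w \<circ> ?t \<in> involutions_on A" by (simp add: involutions_on_def)
    then have "w \<circ> ?t \<in> involutions_on (A - {i, j})"
      by (rule involutions_on_shrink) (use fixed in auto)
    then show "w \<circ> Transposition.transpose i (w i) \<in> involutions_on (A - {i, w i})" using w(2) by simp
  qed
  show "?f ` involutions_on (A - {i, j}) \<subseteq> {w \<in> involutions_on A. w i = j}"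
  proof safe
    fix w assume w: "w \<in> involutions_on (A - {i, j})"
    then have fixed: "w i = i" "w j = j" and inv: "\<And>x. w (w x) = x"
      by (auto simp: involutions_on_def permutes_def)
    have "(w \<circ> ?t) ((w \<circ> ?t) x) = x" for x
    proof (cases "x = i \<or> x = j")
      case False
      then have "w x \<noteq> i" "w x \<noteq> j" using inv[of x] fixed by metis+
      then show ?thesis using False inv[of x] by (simp add: transpose_def)
    qed (use fixed in auto)
    moreover have "w permutes A"
      using involutions_on_mono[OF w, of A] by (auto simp: involutions_on_def)
    then have "(w \<circ> ?t) permutes A" using assms by (intro permutes_compose permutes_swap_id)
    ultimately show "w \<circ> ?t \<in> involutions_on A" by (simp add: involutions_on_def)
    show "(w \<circ> ?t) i = j" using fixed by simp
  qed
qed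

text \<open>At \<open>n = 0\<close> the truncated \<open>n - 1\<close> is harmless because of the
  factor \<open>n\<close>.\<close>

lemma telephone_Suc: "telephone (Suc n) = telephone n + n * telephone (n - 1)"
  by (cases n) auto

text \<open>Sorting by the image of one point \<open>a\<close>: fixing \<open>a\<close> leaves
  \<open>n\<close> points, and each of the \<open>n\<close> other images leaves
  \<open>n - 1\<close>, which is the telephone recursion.\<close>

lemma card_involutions_on: "finite A \<Longrightarrow> card (involutions_on A) = telephone (card A)"
proof (induction "card A" arbitrary: A rule: less_induct)
  case less
  show ?case
  proof (cases "A = {}")
    case True
    then have "involutions_on A = {id}" by (auto simp: involutions_on_def)
    then show ?thesis using True by simp
  next
    case False
    then obtain a where a: "a \<in> A" by blast
    define n where "n = card A - 1"
    have n: "card A = Suc n" using less.prems a by (simp add: n_def card_gt_0_iff Suc_diff_1 False)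
    have "involutions_on A = (\<Union>b\<in>A. {w \<in> involutions_on A. w a = b})"
      using a by (auto simp: involutions_on_def permutes_in_image)
    also have "card \<dots> = (\<Sum>b\<in>A. card {w \<in> involutions_on A. w a = b})"
      using less.prems by (intro card_UN_disjoint) (auto simp: finite_involutions_on)
    also have "\<dots> = card {w \<in> involutions_on A. w a = a} + (\<Sum>b\<in>A - {a}. card {w \<in> involutions_on A. w a = b})"
      using less.prems a by (rule sum.remove)
    also have "(\<Sum>b\<in>A - {a}. card {w \<in> involutions_on A. w a = b}) = (\<Sum>b\<in>A - {a}. telephone (n - 1))"
    proof (rule sum.cong[OF refl])
      fix b assume b: "b \<in> A - {a}"
      have "card (A - {a, b}) = n - 1" using a b n less.prems by (simp add: card_Diff_subset)
      then show "card {w \<in> involutions_on A. w a = b} = telephone (n - 1)"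
        using less.hyps[of "A - {a, b}"] less.prems a b n by (simp add: card_involutions_pair)
    qed
    also have "card {w \<in> involutions_on A. w a = a} = telephone n"
      using less.hyps[of "A - {a}"] less.prems a n by (simp add: involutions_on_fixed)
    finally show ?thesis using less.prems a n by (simp add: telephone_Suc)
  qed
qed

lemma sum_arcs_across:
  assumes "0 < m" "m < L"
  shows "(\<Sum>w\<in>involutions_on {1..L}. arcs_across w m) = m * (L - m) * telephone (L - 2)"
proof -
  let ?I = "involutions_on {1..L}"
  have fin: "finite ?I" by (simp add: finite_involutions_on)
  have "arcs_across w m = (\<Sum>i\<in>{1..m}. \<Sum>j\<in>{m + 1..L}. if w i = j then 1 else 0)" if w: "w \<in> ?I" for w
  proof -
    have "w i \<in> {1..L}" if "i \<in> {1..m}" for i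
      by (subst permutes_in_image[of w]) (use w that assms in \<open>auto simp: involutions_on_def\<close>)
    then have "(\<Sum>i\<in>{1..m}. \<Sum>j\<in>{m + 1..L}. if w i = j then 1 else 0) = (\<Sum>i\<in>{1..m}. if m < w i then 1 else 0)"
      by (intro sum.cong refl) auto
    also have "\<dots> = arcs_across w m" by (simp add: arcs_across_def sum.If_cases Int_def)
    finally show ?thesis by simp
  qed
  then have "(\<Sum>w\<in>?I. arcs_across w m) = (\<Sum>w\<in>?I. \<Sum>i\<in>{1..m}. \<Sum>j\<in>{m + 1..L}. if w i = j then 1 else 0)"
    by simp
  also have "\<dots> = (\<Sum>i\<in>{1..m}. \<Sum>j\<in>{m + 1..L}. \<Sum>w\<in>?I. if w i = j then 1 else 0)"
    by (subst sum.swap) (subst sum.swap[of _ _ ?I], rule refl)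
  also have "\<dots> = (\<Sum>i\<in>{1..m}. \<Sum>j\<in>{m + 1..L}. telephone (L - 2))"
  proof (intro sum.cong refl)
    fix i j assume ij: "i \<in> {1..m}" "j \<in> {m + 1..L}"
    have "(\<Sum>w\<in>?I. if w i = j then 1 else 0) = card {w \<in> ?I. w i = j}"
      using fin by (simp add: sum.If_cases Int_def)
    also have "\<dots> = card (involutions_on ({1..L} - {i, j}))"
      using ij assms by (intro card_involutions_pair) auto
    also have "\<dots> = telephone (card ({1..L} - {i, j}))" by (simp add: card_involutions_on)
    also have "card ({1..L} - {i, j}) = L - 2"
      using ij assms by (subst card_Diff_subset) auto
    finally show "(\<Sum>w\<in>?I. if w i = j then 1 else 0) = telephone (L - 2)" .
  qed
  finally show ?thesis by simp
qed

theorem proposition3: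
  fixes L m :: nat
    and M :: "'w measure"
    and lay :: "'w \<Rightarrow> layout"
    and circ :: "'w \<Rightarrow> gate list"
  assumes "L \<ge> 2" and "0 < m" and "m < L"
    and "prob_space M"
    and "stationary_random_circuit L (1 / 2) M lay circ"
  shows "prob_space.expectation M (\<lambda>\<omega>. renyi0 L m (circuit_state (circ \<omega>)))
           = real m * real (L - m) * (real (telephone (L - 2)) / real (telephone L))"
proof -
  let ?S = "rsf_layouts L" and ?f = "\<lambda>ks. real (arcs_across (layout_perm ks) m)"
  have lay: "lay \<in> measurable M (count_space UNIV)"
    and distr: "distr M (count_space UNIV) lay = measure_pmf (pmf_of_set ?S)"
    and circ: "\<And>\<omega>. \<omega> \<in> space M \<Longrightarrow> rsf_circuit L (lay \<omega>) (circ \<omega>) \<and> generic_circuit L (circ \<omega>)"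
    using assms(5) stationary_distribution_half[OF assms(1)] by (auto simp: stationary_random_circuit_def)
  have S: "?S \<noteq> {}" "finite ?S" using Nil_in_rsf_layouts finite_rsf_layouts by blast+
  have "renyi0 L m (circuit_state (circ \<omega>)) = ?f (lay \<omega>)" if "\<omega> \<in> space M" for \<omega>
  proof -
    have "word_perm (map gate_bond (circ \<omega>)) = layout_perm (lay \<omega>)"
      using circ[OF that] by (auto simp: rsf_circuit_def intro: exchange_word_perm)
    then show ?thesis
      using circ[OF that] assms(3) renyi0_circuit_state[of L "circ \<omega>" m]
      by (auto simp: rsf_circuit_def matchgate_def)
  qed
  \<comment> \<open>Measurability is given for \<open>lay\<close>, so the integrand becomes a
    function of the layout before the change of variables.\<close>
  then have "(\<integral>\<omega>. renyi0 L m (circuit_state (circ \<omega>)) \<partial>M) = (\<integral>\<omega>. ?f (lay \<omega>) \<partial>M)"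
    by (intro Bochner_Integration.integral_cong refl)
  also have "\<dots> = (\<integral>ks. ?f ks \<partial>distr M (count_space UNIV) lay)"
    using lay by (subst integral_distr) auto
  also have "\<dots> = (\<Sum>ks\<in>?S. ?f ks) / real (card ?S)"
    unfolding distr using S by (rule integral_pmf_of_set)
  also have "(\<Sum>ks\<in>?S. ?f ks) = (\<Sum>w\<in>involutions_on {1..L}. real (arcs_across w m))"
    by (rule sum.reindex_bij_betw[OF layout_perm_bij])
  also have "\<dots> = real (m * (L - m) * telephone (L - 2))"
    unfolding sum_arcs_across[OF assms(2,3), symmetric] by simp
  also have "card ?S = telephone L"
    using bij_betw_same_card[OF layout_perm_bij[of L]] by (simp add: card_involutions_on)
  finally show ?thesis by simp
qed

end
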